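(* Let $\mathrm{GSC}(d,l,S)=(K,S,\{F_i\}_{i\in S})$ be an arbitrary generalized Sierpiński carpet, let $(\mathcal{E},\mathcal{F})$ be the canonical Dirichlet form on it, and let $r\in(0,\infty)$ be the associated scaling factor. Then the walk dimension $d_{\mathrm{w}}:=\log_{l}(\#S/r)$ satisfies $$d_{\mathrm{w}}>2.$$
   Context: Framework. Let $d,l\in\mathbb{N}$ with $d\geq 2$, $l\geq 3$, and set $Q_0:=[0,1]^d$. Let $S\subsetneq\{0,1,\ldots,l-1\}^d$ be non-empty, define $f_i\colon\mathbb{R}^d\to\mathbb{R}^d$ by $f_i(x):=l^{-1}i+l^{-1}x$ for $i\in S$, and set $Q_1:=\bigcup_{i\in S}f_i(Q_0)$. Let $K$ be the self-similar set of $\{f_i\}_{i\in S}$, i.e., the unique non-empty compact $K\subset\mathbb{R}^d$ with $K=\bigcup_{i\in S}f_i(K)$; set $F_i:=f_i|_K$ and $\mathrm{GSC}(d,l,S):=(K,S,\{F_i\}_{i\in S})$. Let $\mu$ be the self-similar measure with weights $(1/\#S)_{i\in S}$, i.e., the unique Borel probability measure on $K$ such that $\mu=(\#S)\,\mu\circ F_i$ (i.e. $\mu(A)=(\#S)\mu(F_i(A))$ for Borel $A\subset K$) for every $i\in S$. Here $\#A$ is the cardinality of $A$, $\mathbb{N}=\{1,2,\ldots\}$, $\langle\cdot,\cdot\rangle$ is the inner product of (real) $L^2(K,\mu)$, $\mathcal{C}(K)$ is the set of continuous functions $K\to\mathbb{R}$, and $\mathbf{1}_K$ is the constant function $1$ on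 $K$. Generalized Sierpiński carpet. $\mathrm{GSC}(d,l,S)$ is called a generalized Sierpiński carpet if and only if: (GSC1) $f(Q_1)=Q_1$ for any isometry $f$ of $\mathbb{R}^d$ with $f(Q_0)=Q_0$; (GSC2) $Q_1$ is connected; (GSC3) the interior in $\mathbb{R}^d$ of $Q_1\cap\prod_{k=1}^d[(i_k-\varepsilon_k)l^{-1},(i_k+1)l^{-1}]$ is either empty or connected for any $(i_k)_{k=1}^d\in\mathbb{Z}^d$ and any $(\varepsilon_k)_{k=1}^d\in\{0,1\}^d$; (GSC4) $[0,1]\times\{0\}^{d-1}\subset Q_1$. Canonical Dirichlet form. Let $\mathcal{G}_0:=\{f|_K\mid f\text{ is an isometry of }\mathbb{R}^d,\ f(Q_0)=Q_0\}$ (a finite group of homeomorphisms of $K$). It is known that there is a unique (up to constant multiples of $\mathcal{E}$) regular symmetric Dirichlet form $(\mathcal{E},\mathcal{F})$ on $L^2(K,\mu)$ with $\mathcal{E}(u,u)>0$ for some $u\in\mathcal{F}$, $\mathbf{1}_K\in\mathcal{F}$, $\mathcal{E}(\mathbf{1}_K,\mathbf{1}_K)=0$, and: (GSCDF1) if $u\in\mathcal{F}\cap\mathcal{C}(K)$ and $g\in\mathcal{G}_0$ then $u\circ g\in\mathcal{F}$ and $\mathcal{E}(u\circ g,u\circ g)=\mathcal{E}(u,u)$; (GSCDF2) $\mathcal{F}\cap\mathcal{C}(K)=\{u\in\mathcal{C}(K)\mid u\circ F_i\in\mathcal{F}\text{ for any }i\in S\}$; (GSCDF3) there exists $r\in(0,\infty)$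 such that $\mathcal{E}(u,u)=\sum_{i\in S}\frac1r\mathcal{E}(u\circ F_i,u\circ F_i)$ for any $u\in\mathcal{F}\cap\mathcal{C}(K)$. This $(\mathcal{E},\mathcal{F})$ is called the canonical Dirichlet form on $\mathrm{GSC}(d,l,S)$; the number $r$ in (GSCDF3), called here the scaling factor, is uniquely determined. *)

theory Defs
  imports "HOL-Analysis.Analysis"
begin

text \<open>
  The dimension \<open>d\<close> is \<open>CARD('n)\<close>, and the unit cube \<open>[0,1]\<^sup>d\<close> is \<open>cbox 0 1\<close>.
\<close>

section \<open>Generalized Sierpinski carpets\<close>

definition cell_map :: "nat \<Rightarrow> nat^'n \<Rightarrow> real^'n \<Rightarrow> real^'n" where
  "cell_map l i x = (\<chi> k. real (i $ k) / real l + x $ k / real l)"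

definition first_level :: "nat \<Rightarrow> (nat^'n) set \<Rightarrow> (real^'n) set" where
  "first_level l S = (\<Union>i\<in>S. cell_map l i ` cbox 0 1)"

text \<open>Distance-preserving self-maps of a Euclidean space are automatically bijective.\<close>

definition cube_isometries :: "(real^'n \<Rightarrow> real^'n) set" where
  "cube_isometries = {g. (\<forall>x y. dist (g x) (g y) = dist x y) \<and> g ` cbox 0 1 = cbox 0 1}"

definition carpet_data :: "nat \<Rightarrow> (nat^'n) set \<Rightarrow> bool" where
  "carpet_data l S \<longleftrightarrow>
     CARD('n) \<ge> 2 \<and> l \<ge> 3 \<and> S \<noteq> {} \<and> S \<subset> {i. \<forall>k. i $ k \<in> {0..l - 1}}"

definition GSC1 :: "nat \<Rightarrow> (nat^'n) set \<Rightarrow> bool" where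
  "GSC1 l S \<longleftrightarrow> (\<forall>g\<in>cube_isometries. g ` first_level l S = first_level l S)"

definition GSC2 :: "nat \<Rightarrow> (nat^'n) set \<Rightarrow> bool" where
  "GSC2 l S \<longleftrightarrow> connected (first_level l S)"

definition GSC3 :: "nat \<Rightarrow> (nat^'n) set \<Rightarrow> bool" where
  "GSC3 l S \<longleftrightarrow> (\<forall>(i :: int^'n) (e :: int^'n). (\<forall>k. e $ k \<in> {0, 1}) \<longrightarrow>
     (let U = interior (first_level l S \<inter>
                cbox (\<chi> k. real_of_int (i $ k - e $ k) / real l)
                     (\<chi> k. real_of_int (i $ k + 1) / real l))
      in U = {} \<or> connected U))"

text \<open>
  The index type \<open>'n\<close> carries no order, so the coordinate that is called the first one in
  \<open>[0,1] \<times> {0}\<^sup>d\<^sup>-\<^sup>1\<close> is an arbitrary \<open>k\<close>.  By the symmetry \<open>GSC1\<close>, the choice is immaterial.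
\<close>

definition GSC4 :: "nat \<Rightarrow> (nat^'n) set \<Rightarrow> bool" where
  "GSC4 l S \<longleftrightarrow> (\<exists>k. {x. x $ k \<in> {0..1} \<and> (\<forall>j. j \<noteq> k \<longrightarrow> x $ j = 0)} \<subseteq> first_level l S)"

definition generalized_sierpinski_carpet :: "nat \<Rightarrow> (nat^'n) set \<Rightarrow> bool" where
  "generalized_sierpinski_carpet l S \<longleftrightarrow>
     carpet_data l S \<and> GSC1 l S \<and> GSC2 l S \<and> GSC3 l S \<and> GSC4 l S"

definition self_similar_set :: "nat \<Rightarrow> (nat^'n) set \<Rightarrow> (real^'n) set \<Rightarrow> bool" where
  "self_similar_set l S K \<longleftrightarrow> K \<noteq> {} \<and> compact K \<and> K = (\<Union>i\<in>S. cell_map l i ` K)"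

definition self_similar_measure ::
    "nat \<Rightarrow> (nat^'n) set \<Rightarrow> (real^'n) set \<Rightarrow> (real^'n) measure \<Rightarrow> bool" where
  "self_similar_measure l S K \<mu> \<longleftrightarrow>
     space \<mu> = K \<and> sets \<mu> = sets (restrict_space borel K) \<and> emeasure \<mu> K = 1 \<and>
     (\<forall>i\<in>S. \<forall>A\<in>sets \<mu>. emeasure \<mu> A = of_nat (card S) * emeasure \<mu> (cell_map l i ` A))"


section \<open>Symmetric Dirichlet forms\<close>

text \<open>
  Elements of \<open>L\<^sup>2(M)\<close> are represented by square-integrable functions.  They are defined on the
  whole type, but only their values on \<open>space M\<close> matter.  The domain \<open>F\<close> of a form is therefore
  a set of representatives that is saturated under almost everywhere equality, and the form \<open>E\<close>
  is required to respect that equality; values of \<open>E\<close> outside \<open>F\<close> are irrelevant.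
\<close>

definition L2 :: "'a measure \<Rightarrow> ('a \<Rightarrow> real) set" where
  "L2 M = {u. u \<in> borel_measurable M \<and> integrable M (\<lambda>x. (u x)\<^sup>2)}"

definition L2_inner :: "'a measure \<Rightarrow> ('a \<Rightarrow> real) \<Rightarrow> ('a \<Rightarrow> real) \<Rightarrow> real" where
  "L2_inner M u v = (\<integral>x. u x * v x \<partial>M)"

definition symmetric_form ::
    "'a measure \<Rightarrow> (('a \<Rightarrow> real) \<Rightarrow> ('a \<Rightarrow> real) \<Rightarrow> real) \<Rightarrow> ('a \<Rightarrow> real) set \<Rightarrow> bool" where
  "symmetric_form M E F \<longleftrightarrow>
     F \<subseteq> L2 M \<and>
     (\<forall>u\<in>F. \<forall>v\<in>L2 M. (AE x in M. u x = v x) \<longrightarrow> v \<in> F) \<and>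
     (\<forall>u\<in>F. \<forall>u'\<in>F. \<forall>v\<in>F. (AE x in M. u x = u' x) \<longrightarrow> E u v = E u' v) \<and>
     (\<lambda>x. 0) \<in> F \<and>
     (\<forall>u\<in>F. \<forall>v\<in>F. (\<lambda>x. u x + v x) \<in> F) \<and>
     (\<forall>c. \<forall>u\<in>F. (\<lambda>x. c * u x) \<in> F) \<and>
     (\<forall>u\<in>F. \<forall>v\<in>F. E u v = E v u) \<and>
     (\<forall>u\<in>F. \<forall>v\<in>F. \<forall>w\<in>F. E (\<lambda>x. u x + v x) w = E u w + E v w) \<and>
     (\<forall>c. \<forall>u\<in>F. \<forall>w\<in>F. E (\<lambda>x. c * u x) w = c * E u w) \<and>
     (\<forall>u\<in>F. E u u \<ge> 0)"

definition E1_dist ::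
    "'a measure \<Rightarrow> (('a \<Rightarrow> real) \<Rightarrow> ('a \<Rightarrow> real) \<Rightarrow> real) \<Rightarrow> ('a \<Rightarrow> real) \<Rightarrow> ('a \<Rightarrow> real) \<Rightarrow> real" where
  "E1_dist M E u v =
     (let w = (\<lambda>x. u x - v x) in sqrt (E w w + L2_inner M w w))"

definition densely_defined :: "'a measure \<Rightarrow> ('a \<Rightarrow> real) set \<Rightarrow> bool" where
  "densely_defined M F \<longleftrightarrow> (\<forall>f\<in>L2 M. \<forall>e>0. \<exists>u\<in>F.
     sqrt (L2_inner M (\<lambda>x. f x - u x) (\<lambda>x. f x - u x)) < e)"

definition closed_form ::
    "'a measure \<Rightarrow> (('a \<Rightarrow> real) \<Rightarrow> ('a \<Rightarrow> real) \<Rightarrow> real) \<Rightarrow> ('a \<Rightarrow> real) set \<Rightarrow> bool" where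
  "closed_form M E F \<longleftrightarrow>
     (\<forall>u :: nat \<Rightarrow> 'a \<Rightarrow> real. (\<forall>n. u n \<in> F) \<longrightarrow>
        (\<forall>e>0. \<exists>N. \<forall>m\<ge>N. \<forall>n\<ge>N. E1_dist M E (u m) (u n) < e) \<longrightarrow>
        (\<exists>v\<in>F. (\<lambda>n. E1_dist M E (u n) v) \<longlonglongrightarrow> 0))"

definition markovian ::
    "(('a \<Rightarrow> real) \<Rightarrow> ('a \<Rightarrow> real) \<Rightarrow> real) \<Rightarrow> ('a \<Rightarrow> real) set \<Rightarrow> bool" where
  "markovian E F \<longleftrightarrow>
     (\<forall>u\<in>F. let v = (\<lambda>x. min (max (u x) 0) 1) in v \<in> F \<and> E v v \<le> E u u)"

definition dirichlet_form ::
    "'a measure \<Rightarrow> (('a \<Rightarrow> real) \<Rightarrow> ('a \<Rightarrow> real) \<Rightarrow> real) \<Rightarrow> ('a \<Rightarrow> real) set \<Rightarrow> bool" where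
  "dirichlet_form M E F \<longleftrightarrow>
     symmetric_form M E F \<and> densely_defined M F \<and> closed_form M E F \<and> markovian E F"

definition cont_funs :: "'a::topological_space set \<Rightarrow> ('a \<Rightarrow> real) set" where
  "cont_funs K = {u. continuous_on K u}"

text \<open>Regularity is stated for a compact state space \<open>K = space M\<close>, so that \<open>C\<^sub>c(K) = C(K)\<close>.\<close>

definition regular_form ::
    "'a::topological_space measure \<Rightarrow> (('a \<Rightarrow> real) \<Rightarrow> ('a \<Rightarrow> real) \<Rightarrow> real) \<Rightarrow>
     ('a \<Rightarrow> real) set \<Rightarrow> bool" where
  "regular_form M E F \<longleftrightarrow>
     (\<forall>u\<in>F. \<forall>e>0. \<exists>v\<in>F \<inter> cont_funs (space M). E1_dist M E u v < e) \<and>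
     (\<forall>u\<in>cont_funs (space M). \<forall>e>0. \<exists>v\<in>F \<inter> cont_funs (space M).
        \<forall>x\<in>space M. \<bar>u x - v x\<bar> < e)"


section \<open>The canonical Dirichlet form\<close>

text \<open>
  A composite \<open>u \<circ> g\<close> or \<open>u \<circ> cell_map l i\<close> only matters on \<open>K\<close>, which these maps send into
  itself; so the restrictions of \<open>g\<close> and \<open>cell_map l i\<close> to \<open>K\<close> need no separate notation.
\<close>

definition GSCDF1 ::
    "(real^'n) set \<Rightarrow> ((real^'n \<Rightarrow> real) \<Rightarrow> (real^'n \<Rightarrow> real) \<Rightarrow> real) \<Rightarrow>
     (real^'n \<Rightarrow> real) set \<Rightarrow> bool" where
  "GSCDF1 K E F \<longleftrightarrow> (\<forall>u\<in>F \<inter> cont_funs K. \<forall>g\<in>cube_isometries.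
     u \<circ> g \<in> F \<and> E (u \<circ> g) (u \<circ> g) = E u u)"

definition GSCDF2 ::
    "nat \<Rightarrow> (nat^'n) set \<Rightarrow> (real^'n) set \<Rightarrow> (real^'n \<Rightarrow> real) set \<Rightarrow> bool" where
  "GSCDF2 l S K F \<longleftrightarrow>
     F \<inter> cont_funs K = {u \<in> cont_funs K. \<forall>i\<in>S. u \<circ> cell_map l i \<in> F}"

definition scaling_factor ::
    "nat \<Rightarrow> (nat^'n) set \<Rightarrow> (real^'n) set \<Rightarrow>
     ((real^'n \<Rightarrow> real) \<Rightarrow> (real^'n \<Rightarrow> real) \<Rightarrow> real) \<Rightarrow> (real^'n \<Rightarrow> real) set \<Rightarrow> real \<Rightarrow> bool" where
  "scaling_factor l S K E F r \<longleftrightarrow> r > 0 \<and>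
     (\<forall>u\<in>F \<inter> cont_funs K.
        E u u = (\<Sum>i\<in>S. 1 / r * E (u \<circ> cell_map l i) (u \<circ> cell_map l i)))"

definition GSCDF3 ::
    "nat \<Rightarrow> (nat^'n) set \<Rightarrow> (real^'n) set \<Rightarrow>
     ((real^'n \<Rightarrow> real) \<Rightarrow> (real^'n \<Rightarrow> real) \<Rightarrow> real) \<Rightarrow> (real^'n \<Rightarrow> real) set \<Rightarrow> bool" where
  "GSCDF3 l S K E F \<longleftrightarrow> (\<exists>r. scaling_factor l S K E F r)"

definition canonical_dirichlet_form ::
    "nat \<Rightarrow> (nat^'n) set \<Rightarrow> (real^'n) set \<Rightarrow> (real^'n) measure \<Rightarrow>
     ((real^'n \<Rightarrow> real) \<Rightarrow> (real^'n \<Rightarrow> real) \<Rightarrow> real) \<Rightarrow> (real^'n \<Rightarrow> real) set \<Rightarrow> bool" where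
  "canonical_dirichlet_form l S K \<mu> E F \<longleftrightarrow>
     dirichlet_form \<mu> E F \<and> regular_form \<mu> E F \<and>
     (\<exists>u\<in>F. E u u > 0) \<and>
     (\<lambda>x. 1) \<in> F \<and> E (\<lambda>x. 1) (\<lambda>x. 1) = 0 \<and>
     GSCDF1 K E F \<and> GSCDF2 l S K F \<and> GSCDF3 l S K E F"

definition walk_dimension :: "nat \<Rightarrow> (nat^'n) set \<Rightarrow> real \<Rightarrow> real" where
  "walk_dimension l S r = log (real l) (real (card S) / r)"

end

(*
  Only continuous functions of the domain and the symmetry GSC1 matter. Suppose that
  #S <= r l^2. Fix a coordinate direction k and consider functions with values 0 and 1 on the two
  faces of the cube orthogonal to k. Their infimal energy e is positive: otherwise one could
  interpolate any function on fine grids by copies of functions of tiny energy, and the form would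
  vanish. If u is a minimiser, symmetric under the reflections in the other directions, then the
  function v that equals (u + i_k)/l on the cell i has the same boundary values and energy
  (#S/(r l^2)) E(u,u) <= E(u,u), so it is a minimiser too, hence orthogonal to every w that vanishes
  on both faces. For w interpolating grid values q, symmetry reduces E(v,w) to a nonzero multiple of
  the sum over the cells of S of the difference of the sums of q over the two faces orthogonal to k.
  Since S is neither empty nor everything, it contains exactly one of two neighbouring cells (for
  some k), and q can be chosen so that only these two cells contribute to the sum, a contradiction.
  Minimisers are replaced by almost minimisers, at the cost of an error that tends to 0.
*)
theory Submission
  imports Defs
begin

text \<open>The domain is not explicit: not even the coordinate functions are known to belong to it,
  so every test function is built from crossing functions. Minima serve for this, because they stay
  in the domain with \<open>Q (min u v) \<le> Q u + Q v\<close>. With corners of the cube indexed by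
  the set of coordinates equal to 1, they yield one \<open>bump\<close> per corner: a partition of
  unity whose pieces have energy controlled by that of the crossing functions. Pasting needs
  pointwise agreement on common faces, hence continuous functions; a minimising sequence need not
  have a continuous limit, hence almost minimisers. The nonzero multiple is
  \<open>\<alpha> = E u (bump U {k})\<close>. Let \<open>W\<close> be the sum of the
  \<open>n\<close> bumps at corners with k-th coordinate 1. It has the boundary values of
  \<open>u\<close>, so \<open>E u u\<close> is close to \<open>E u W = n * \<alpha>\<close>, and
  \<alpha> stays away from 0 because \<open>E u u \<ge> e\<close>. The bumps, \<open>w\<close> and
  \<open>W\<close> are fixed before the tolerance \<delta>, so the final bound
  \<open>e\<^sup>2 \<le> C * \<delta>\<close> has \<open>C\<close> independent of \<delta>.\<close>

lemma quadratic_nonneg_imp: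
  fixes a b c :: real
  assumes "\<And>t. a * t\<^sup>2 + 2 * b * t + c \<ge> 0" "a \<ge> 0"
  shows "b\<^sup>2 \<le> a * c"
proof (cases "a = 0")
  case True
  have "b = 0"
  proof (rule ccontr)
    assume "b \<noteq> 0"
    \<comment> \<open>For \<open>a = 0\<close> the polynomial takes the value -1 at this
      argument.\<close>
    then show False using assms(1)[of "- (c + 1) / (2 * b)"] True by (simp add: field_simps)
  qed
  then show ?thesis using True by simp
next
  case False
  then have a: "a > 0" using assms(2) by simp
  have "a * (a * (-b/a)\<^sup>2 + 2 * b * (-b/a) + c) \<ge> 0"
    using assms(1)[of "-b/a"] a by (intro mult_nonneg_nonneg) auto
  moreover have "a * (a * (-b/a)\<^sup>2 + 2 * b * (-b/a) + c) = a * c - b\<^sup>2"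
    using a by (simp add: field_simps power2_eq_square)
  ultimately show ?thesis by simp
qed

section \<open>Quadratic forms with the Markov property\<close>

text \<open>Equality is asked for on \<open>K\<close> only, since functions are defined on the whole
  type. The locale serves twice: for the full domain of the Dirichlet form and for its continuous
  members.\<close>

locale quadratic_form =
  fixes K :: "'a set" and D :: "('a \<Rightarrow> real) set"
    and E :: "('a \<Rightarrow> real) \<Rightarrow> ('a \<Rightarrow> real) \<Rightarrow> real"
  assumes D_cong: "u \<in> D \<Longrightarrow> (\<And>x. x \<in> K \<Longrightarrow> v x = u x) \<Longrightarrow> v \<in> D"
    and E_cong1: "u \<in> D \<Longrightarrow> u' \<in> D \<Longrightarrow> v \<in> D \<Longrightarrow> (\<And>x. x \<in> K \<Longrightarrow> u x = u' x) \<Longrightarrow> E u v = E u' v"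
    and one: "(\<lambda>x. 1) \<in> D" and E_one: "E (\<lambda>x. 1) (\<lambda>x. 1) = 0"
    and add: "u \<in> D \<Longrightarrow> v \<in> D \<Longrightarrow> (\<lambda>x. u x + v x) \<in> D"
    and scale: "u \<in> D \<Longrightarrow> (\<lambda>x. c * u x) \<in> D"
    and E_sym: "u \<in> D \<Longrightarrow> v \<in> D \<Longrightarrow> E u v = E v u"
    and E_add: "u \<in> D \<Longrightarrow> v \<in> D \<Longrightarrow> w \<in> D \<Longrightarrow> E (\<lambda>x. u x + v x) w = E u w + E v w"
    and E_scale: "u \<in> D \<Longrightarrow> w \<in> D \<Longrightarrow> E (\<lambda>x. c * u x) w = c * E u w"
    and E_nonneg: "u \<in> D \<Longrightarrow> E u u \<ge> 0"
begin

abbreviation Q where "Q u \<equiv> E u u"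

lemma E_cong:
  assumes "u \<in> D" "v \<in> D" "\<And>x. x \<in> K \<Longrightarrow> u' x = u x" "\<And>x. x \<in> K \<Longrightarrow> v' x = v x"
  shows "E u' v' = E u v"
proof -
  have u': "u' \<in> D" and v': "v' \<in> D"
    using D_cong[OF assms(1,3)] D_cong[OF assms(2,4)] by auto
  have "E u' v' = E u v'" by (rule E_cong1[OF u' assms(1) v' assms(3)])
  also have "\<dots> = E v' u" by (rule E_sym[OF assms(1) v'])
  also have "\<dots> = E v u" by (rule E_cong1[OF v' assms(2,1) assms(4)])
  also have "\<dots> = E u v" by (rule E_sym[OF assms(2,1)])
  finally show ?thesis .
qed

lemma const: "(\<lambda>x. c) \<in> D"
  using scale[OF one, of c] by simp

lemma diff: "u \<in> D \<Longrightarrow> v \<in> D \<Longrightarrow> (\<lambda>x. u x - v x) \<in> D"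
  using add[of u "\<lambda>x. -1 * v x"] scale[of v "-1"] by simp

lemma sum_D: "(\<And>i. i \<in> I \<Longrightarrow> f i \<in> D) \<Longrightarrow> (\<lambda>x. \<Sum>i\<in>I. f i x) \<in> D"
  by (induction I rule: infinite_finite_induct) (auto intro: const add)

lemma E_add2: "u \<in> D \<Longrightarrow> v \<in> D \<Longrightarrow> w \<in> D \<Longrightarrow> E w (\<lambda>x. u x + v x) = E w u + E w v"
  by (subst (1 2 3) E_sym) (auto intro: add E_add)

lemma E_scale2: "u \<in> D \<Longrightarrow> w \<in> D \<Longrightarrow> E w (\<lambda>x. c * u x) = c * E w u"
  by (subst (1 2) E_sym) (auto intro: scale E_scale)

lemma E_diff: "u \<in> D \<Longrightarrow> v \<in> D \<Longrightarrow> w \<in> D \<Longrightarrow> E (\<lambda>x. u x - v x) w = E u w - E v w"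
  using E_add[of u "\<lambda>x. -1 * v x" w] E_scale[of v w "-1"] scale[of v "-1"] by simp

lemma E_diff2: "u \<in> D \<Longrightarrow> v \<in> D \<Longrightarrow> w \<in> D \<Longrightarrow> E w (\<lambda>x. u x - v x) = E w u - E w v"
  by (subst (1 2 3) E_sym) (auto intro: diff E_diff)

lemma E_zero: "w \<in> D \<Longrightarrow> E (\<lambda>x. 0) w = 0"
  using E_scale[OF one, of w 0] by simp

lemma E_sum:
  "(\<And>i. i \<in> I \<Longrightarrow> f i \<in> D) \<Longrightarrow> w \<in> D \<Longrightarrow> E (\<lambda>x. \<Sum>i\<in>I. f i x) w = (\<Sum>i\<in>I. E (f i) w)"
  by (induction I rule: infinite_finite_induct) (auto simp: E_zero E_add sum_D)

lemma E_sum2: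
  assumes "\<And>i. i \<in> I \<Longrightarrow> f i \<in> D" "w \<in> D"
  shows "E w (\<lambda>x. \<Sum>i\<in>I. f i x) = (\<Sum>i\<in>I. E w (f i))"
proof -
  have "E w (\<lambda>x. \<Sum>i\<in>I. f i x) = (\<Sum>i\<in>I. E (f i) w)"
    using E_sym[OF assms(2) sum_D, of I f] E_sum[of I f w] assms by simp
  also have "\<dots> = (\<Sum>i\<in>I. E w (f i))"
    using assms by (intro sum.cong refl E_sym) auto
  finally show ?thesis .
qed

lemma Q_scale: "u \<in> D \<Longrightarrow> Q (\<lambda>x. c * u x) = c\<^sup>2 * Q u"
  by (simp add: E_scale E_scale2 scale power2_eq_square)

lemma Q_add: "u \<in> D \<Longrightarrow> v \<in> D \<Longrightarrow> Q (\<lambda>x. u x + v x) = Q u + 2 * E u v + Q v"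
  by (simp add: E_add E_add2 add E_sym[of v u])

lemma Q_diff: "u \<in> D \<Longrightarrow> v \<in> D \<Longrightarrow> Q (\<lambda>x. u x - v x) = Q u - 2 * E u v + Q v"
  by (simp add: E_diff E_diff2 diff E_sym[of v u])

lemma Q_add_scale:
  "u \<in> D \<Longrightarrow> v \<in> D \<Longrightarrow> Q (\<lambda>x. u x + t * v x) = Q v * t\<^sup>2 + 2 * E u v * t + Q u"
  using Q_add[OF _ scale, of u v t] by (simp add: Q_scale E_scale2)

text \<open>Quantitative first variation: minimality up to \<delta> along the line
  \<open>u + t v\<close> makes a quadratic polynomial in \<open>t\<close> nonnegative, and its
  discriminant bounds the linear term. Taking \<delta> to be \<open>Q u\<close> gives the
  Cauchy-Schwarz inequality.\<close>

lemma almost_orthogonal: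
  assumes "u \<in> D" "v \<in> D" "\<And>t. Q (\<lambda>x. u x + t * v x) \<ge> Q u - \<delta>"
  shows "(E u v)\<^sup>2 \<le> \<delta> * Q v"
proof -
  have "Q v * t\<^sup>2 + 2 * E u v * t + \<delta> \<ge> 0" for t
    using assms(3)[of t] assms(1,2) by (simp add: Q_add_scale)
  then show ?thesis
    using quadratic_nonneg_imp[of "Q v" "E u v" \<delta>] E_nonneg[OF assms(2)] by (simp add: mult.commute)
qed

lemma Cauchy_Schwarz:
  assumes "u \<in> D" "v \<in> D" shows "(E u v)\<^sup>2 \<le> Q u * Q v"
proof (rule almost_orthogonal[OF assms])
  show "Q u - Q u \<le> Q (\<lambda>x. u x + t * v x)" for t
    using E_nonneg[OF add[OF assms(1) scale[OF assms(2)]]] by simp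
qed

lemma E_one_right:
  assumes "u \<in> D" shows "E u (\<lambda>x. 1) = 0"
  using Cauchy_Schwarz[OF assms one] by (simp add: E_one)

lemma E_one_left:
  assumes "u \<in> D" shows "E (\<lambda>x. 1) u = 0"
  by (subst E_sym[OF one assms]) (rule E_one_right[OF assms])

lemma E_le_avg: "u \<in> D \<Longrightarrow> v \<in> D \<Longrightarrow> 2 * E u v \<le> Q u + Q v"
  using E_nonneg[OF diff, of u v] by (simp add: Q_diff)

text \<open>The factor \<open>card I\<close> pays for the mixed terms. It is exact for equal
  summands, so averaging functions of equal energy loses nothing.\<close>

lemma Q_sum_le:
  assumes "\<And>i. i \<in> I \<Longrightarrow> f i \<in> D"
  shows "Q (\<lambda>x. \<Sum>i\<in>I. f i x) \<le> card I * (\<Sum>i\<in>I. Q (f i))"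
proof -
  have "Q (\<lambda>x. \<Sum>i\<in>I. f i x) = (\<Sum>i\<in>I. \<Sum>j\<in>I. E (f i) (f j))"
    using assms by (simp add: E_sum sum_D E_sum2)
  also have "\<dots> \<le> (\<Sum>i\<in>I. \<Sum>j\<in>I. (Q (f i) + Q (f j)) / 2)"
  proof (intro sum_mono)
    fix i j assume "i \<in> I" "j \<in> I"
    then have "2 * E (f i) (f j) \<le> Q (f i) + Q (f j)"
      by (intro E_le_avg assms)
    then show "E (f i) (f j) \<le> (Q (f i) + Q (f j)) / 2" by simp
  qed
  also have "\<dots> = card I * (\<Sum>i\<in>I. Q (f i))"
    by (simp add: sum.distrib add_divide_distrib sum_divide_distrib[symmetric]
        sum_distrib_left[symmetric])
  finally show ?thesis .
qed

lemma affine: "u \<in> D \<Longrightarrow> (\<lambda>x. a * u x + c) \<in> D"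
  by (intro add scale const)

lemma E_const_left: "u \<in> D \<Longrightarrow> E (\<lambda>x. c) u = 0"
  using E_scale[OF one, of u c] by (simp add: E_one_left)

lemma E_affine: "u \<in> D \<Longrightarrow> w \<in> D \<Longrightarrow> E (\<lambda>x. a * u x + c) w = a * E u w"
  by (simp add: E_add scale const E_scale E_const_left)

lemma Q_affine: "u \<in> D \<Longrightarrow> Q (\<lambda>x. a * u x + c) = a\<^sup>2 * Q u"
  by (simp add: E_affine affine E_sym[of u "\<lambda>x. a * u x + c"] power2_eq_square)

lemma Q_add_le: "u \<in> D \<Longrightarrow> v \<in> D \<Longrightarrow> Q (\<lambda>x. u x + v x) \<le> 2 * Q u + 2 * Q v"
  using E_le_avg[of u v] by (simp add: Q_add)

lemma Q_diff_le: "u \<in> D \<Longrightarrow> v \<in> D \<Longrightarrow> Q (\<lambda>x. u x - v x) \<le> 2 * Q u + 2 * Q v"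
  using E_nonneg[OF add, of u v] by (simp add: Q_add Q_diff)

end

section \<open>Lattice operations and their energy\<close>

locale markov_form = quadratic_form K D E for K :: "'a::topological_space set" and D E +
  assumes cont: "u \<in> D \<Longrightarrow> continuous_on K u"
    and pos_part: "u \<in> D \<Longrightarrow> (\<lambda>x. max (u x) 0) \<in> D"
    and E_pos_part: "u \<in> D \<Longrightarrow> E (\<lambda>x. max (u x) 0) (\<lambda>x. max (u x) 0) \<le> E u u"
begin

lemma neg_part: "u \<in> D \<Longrightarrow> (\<lambda>x. max (- u x) 0) \<in> D"
  using pos_part[OF scale, of u "-1"] by simp

text \<open>Since \<open>u\<^sup>+\<close> is the positive part of \<open>u\<^sup>+ - t u\<^sup>-\<close> for every \<open>t \<ge> 0\<close>,
  contraction forces the first order term in \<open>t\<close> to have the right sign.\<close>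

lemma E_pos_neg_part:
  assumes u: "u \<in> D"
  shows "E (\<lambda>x. max (u x) 0) (\<lambda>x. max (- u x) 0) \<le> 0"
proof (rule ccontr)
  let ?p = "\<lambda>x. max (u x) 0" and ?n = "\<lambda>x. max (- u x) 0"
  assume "\<not> E ?p ?n \<le> 0"
  then have pos: "E ?p ?n > 0" by simp
  have p: "?p \<in> D" and n: "?n \<in> D" using u pos_part neg_part by auto
  have le: "2 * E ?p ?n \<le> t * Q ?n" if t: "t > 0" for t
  proof -
    have "(\<lambda>x. max (?p x + (- t) * ?n x) 0) = ?p"
      using t by (auto simp: fun_eq_iff max_def mult_le_0_iff not_le)
    then have "Q ?p \<le> Q (\<lambda>x. ?p x + (- t) * ?n x)"
      using E_pos_part[OF add[OF p scale[OF n]], of "- t"] by simp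
    also have "\<dots> = Q ?n * t\<^sup>2 - 2 * E ?p ?n * t + Q ?p"
      using Q_add_scale[OF p n, of "- t"] by simp
    finally have "t * (2 * E ?p ?n) \<le> t * (t * Q ?n)" by (simp add: power2_eq_square algebra_simps)
    then show ?thesis using t by (simp only: mult_le_cancel_left_pos)
  qed
  define t where "t = E ?p ?n / (Q ?n + 1)"
  have "t > 0" using pos E_nonneg[OF n] by (simp add: t_def add_nonneg_pos)
  moreover have "t * (Q ?n + 1) = E ?p ?n" using E_nonneg[OF n] by (simp add: t_def)
  ultimately show False using le[of t] pos by (simp add: algebra_simps)
qed

text \<open>The energies of \<open>\<bar>u\<bar>\<close> and \<open>u\<close> differ by four times
  the mixed term of positive and negative part, whose sign is known.\<close>

lemma abs_D:
  assumes u: "u \<in> D" shows "(\<lambda>x. \<bar>u x\<bar>) \<in> D" "Q (\<lambda>x. \<bar>u x\<bar>) \<le> Q u"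
proof -
  let ?p = "\<lambda>x. max (u x) 0" and ?n = "\<lambda>x. max (- u x) 0"
  have p: "?p \<in> D" and n: "?n \<in> D" using u pos_part neg_part by auto
  have eq: "(\<lambda>x. \<bar>u x\<bar>) = (\<lambda>x. ?p x + ?n x)" "u = (\<lambda>x. ?p x - ?n x)" by auto
  show "(\<lambda>x. \<bar>u x\<bar>) \<in> D" unfolding eq(1) by (rule add[OF p n])
  have "Q (\<lambda>x. \<bar>u x\<bar>) = Q ?p + 2 * E ?p ?n + Q ?n" unfolding eq(1) by (rule Q_add[OF p n])
  moreover have "Q u = Q ?p - 2 * E ?p ?n + Q ?n" using Q_diff[OF p n] eq(2) by simp
  ultimately show "Q (\<lambda>x. \<bar>u x\<bar>) \<le> Q u" using E_pos_neg_part[OF u] by simp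
qed

text \<open>Write the minimum as half of \<open>u + v - \<bar>u - v\<bar>\<close>. The parallelogram
  law bounds the energy of this difference; after the absolute value is dropped it applies once
  more, to \<open>u + v\<close> and \<open>u - v\<close>.\<close>

lemma min_D:
  assumes u: "u \<in> D" and v: "v \<in> D"
  shows "(\<lambda>x. min (u x) (v x)) \<in> D" "Q (\<lambda>x. min (u x) (v x)) \<le> Q u + Q v"
proof -
  let ?a = "\<lambda>x. \<bar>u x - v x\<bar>" and ?s = "\<lambda>x. u x + v x"
  have a: "?a \<in> D" "Q ?a \<le> Q (\<lambda>x. u x - v x)" using abs_D[OF diff[OF u v]] by auto
  have s: "?s \<in> D" by (rule add[OF u v])
  have eq: "(\<lambda>x. min (u x) (v x)) = (\<lambda>x. (1/2) * (?s x - ?a x))" by (auto simp: min_def)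
  show "(\<lambda>x. min (u x) (v x)) \<in> D" unfolding eq by (intro scale diff s a)
  have "Q (\<lambda>x. min (u x) (v x)) = (1/4) * Q (\<lambda>x. ?s x - ?a x)"
    unfolding eq by (subst Q_scale) (auto intro: diff s a simp: power2_eq_square)
  also have "\<dots> \<le> (1/2) * (Q ?s + Q ?a)"
    using E_nonneg[OF add[OF s a(1)]] by (simp add: Q_diff Q_add s a(1))
  also have "\<dots> \<le> Q u + Q v"
    using a(2) Q_add[OF u v] Q_diff[OF u v] by simp
  finally show "Q (\<lambda>x. min (u x) (v x)) \<le> Q u + Q v" .
qed

lemma clamp_D:
  assumes u: "u \<in> D"
  shows "(\<lambda>x. min (max (u x) 0) 1) \<in> D" "Q (\<lambda>x. min (max (u x) 0) 1) \<le> Q u"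
proof -
  let ?p = "\<lambda>x. max (u x) 0"
  have p: "?p \<in> D" "Q ?p \<le> Q u" using u pos_part E_pos_part by auto
  show "(\<lambda>x. min (?p x) 1) \<in> D" "Q (\<lambda>x. min (?p x) 1) \<le> Q u"
    using min_D[OF p(1) one] p(2) by (auto simp: E_one)
qed

end

section \<open>Symmetries of the cube and self-similar sets\<close>

definition reflect :: "'n set \<Rightarrow> real^'n \<Rightarrow> real^'n" where
  "reflect B x = (\<chi> k. if k \<in> B then 1 - x $ k else x $ k)"

definition swap :: "'n \<Rightarrow> 'n \<Rightarrow> 'a^'n \<Rightarrow> 'a^'n" where
  "swap a b x = (\<chi> k. x $ Transposition.transpose a b k)"

lemma reflect_nth: "reflect B x $ k = (if k \<in> B then 1 - x $ k else x $ k)"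
  by (simp add: reflect_def)

lemma swap_nth: "swap a b x $ k = x $ Transposition.transpose a b k"
  by (simp add: swap_def)

lemma reflect_reflect: "reflect A (reflect B x) = reflect (sym_diff A B) x"
  by (auto simp: vec_eq_iff reflect_nth)

lemma swap_swap: "swap a b (swap a b x) = x"
  by (auto simp: vec_eq_iff swap_nth)

lemma mem_unit_cube: "(x :: real^'n) \<in> cbox 0 1 \<longleftrightarrow> (\<forall>k. 0 \<le> x $ k \<and> x $ k \<le> 1)"
  by (simp add: mem_box_cart)

lemma cube_isometryI:
  fixes g :: "real^'n \<Rightarrow> real^'n"
  assumes "\<And>x y. dist (g x) (g y) = dist x y" "\<And>x. g (g x) = x"
    and "\<And>x. x \<in> cbox 0 1 \<Longrightarrow> g x \<in> cbox 0 1"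
  shows "g \<in> cube_isometries"
proof -
  have "x \<in> g ` cbox 0 1" if "x \<in> cbox 0 1" for x
    using assms(2)[of x] assms(3)[OF that] by (metis imageI)
  then show ?thesis using assms(1,3) by (auto simp: cube_isometries_def)
qed

lemma reflect_isometry: "reflect B \<in> cube_isometries"
proof -
  have "dist (reflect B x) (reflect B y) = dist x y" for x y
    unfolding dist_vec_def by (rule arg_cong[where f = "\<lambda>f. L2_set f UNIV"])
      (auto simp: reflect_nth dist_real_def fun_eq_iff)
  moreover have "reflect B x \<in> cbox 0 1" if "x \<in> cbox 0 1" for x
    using that by (auto simp: mem_unit_cube reflect_nth)
  moreover have "reflect B (reflect B x) = x" for x
    by (auto simp: vec_eq_iff reflect_nth)
  ultimately show ?thesis by (intro cube_isometryI)
qed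

lemma swap_isometry: "swap (a::'n) b \<in> (cube_isometries :: (real^'n \<Rightarrow> real^'n) set)"
proof -
  have "dist (swap a b x) (swap a b y) = dist x y" for x y :: "real^'n"
    unfolding dist_vec_def L2_set_def swap_nth
    by (intro arg_cong[where f = sqrt] sum.reindex_bij_betw[OF bij_transpose])
  moreover have "swap a b x \<in> cbox 0 1" if "x \<in> cbox 0 1" for x :: "real^'n"
    using that by (auto simp: mem_unit_cube swap_nth)
  ultimately show ?thesis by (intro cube_isometryI swap_swap)
qed

section \<open>Cell maps and self-similar sets\<close>

lemma cell_map_nth: "cell_map l i x $ k = (real (i $ k) + x $ k) / real l"
  by (simp add: cell_map_def add_divide_distrib)

lemma cell_map_eq_iff:
  "l > 0 \<Longrightarrow> cell_map l i x = cell_map l j y \<longleftrightarrow> (\<forall>k. real (i $ k) + x $ k = real (j $ k) + y $ k)"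
  by (simp add: vec_eq_iff cell_map_nth)

lemma dist_cell_map: "dist (cell_map l i x) (cell_map l i y) = dist x y / real l"
proof -
  have "cell_map l i x = (1 / real l) *\<^sub>R ((\<chi> k. real (i $ k)) + x)" for x
    by (simp add: vec_eq_iff cell_map_nth)
  then show ?thesis by (simp only: dist_norm flip: scaleR_diff_right) simp
qed

lemma continuous_cell_map: "continuous_on A (cell_map l i)"
proof -
  have "cell_map l i = (\<lambda>x. (1 / real l) *\<^sub>R ((\<chi> k. real (i $ k)) + x))"
    by (simp add: fun_eq_iff vec_eq_iff cell_map_nth)
  then show ?thesis by (simp only:) (intro continuous_intros)
qed

locale self_similar =
  fixes l :: nat and S :: "(nat^'n) set" and K :: "(real^'n) set"
  assumes l_ge: "l \<ge> 2" and index_less: "i \<in> S \<Longrightarrow> i $ k < l"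
    and K_ne: "K \<noteq> {}" and K_compact: "compact K"
    and K_eq: "K = (\<Union>i\<in>S. cell_map l i ` K)"
begin

lemma l_pos: "l > 0" using l_ge by simp

lemma S_finite: "finite S"
proof -
  have "S \<subseteq> (\<lambda>f. \<chi> k. f k) ` (UNIV \<rightarrow>\<^sub>E {..<l})"
  proof
    fix i assume "i \<in> S"
    then show "i \<in> (\<lambda>f. \<chi> k. f k) ` (UNIV \<rightarrow>\<^sub>E {..<l})"
      by (intro image_eqI[of _ _ "\<lambda>k. i $ k"]) (auto simp: index_less)
  qed
  then show ?thesis by (rule finite_subset) (simp add: finite_PiE)
qed

lemma S_ne: "S \<noteq> {}" using K_ne K_eq by auto

lemma cell_in: "i \<in> S \<Longrightarrow> x \<in> K \<Longrightarrow> cell_map l i x \<in> K"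
  using K_eq by blast

lemma cellE:
  assumes "x \<in> K" obtains i y where "i \<in> S" "y \<in> K" "x = cell_map l i y"
  using assms K_eq by blast

text \<open>In one coordinate the right-hand side is the map of the last cell, whose fixed point is
  1.\<close>

lemma contraction_le:
  assumes "M \<le> (real (l - 1) + M) / real l" shows "M \<le> 1"
proof -
  have "real l * M \<le> real l - 1 + M" using assms l_ge by (simp add: field_simps of_nat_diff)
  then have "(real l - 1) * (M - 1) \<le> 0" by (simp add: algebra_simps)
  then show ?thesis using l_ge by (simp add: mult_le_0_iff)
qed

text \<open>Each coordinate attains its extrema on \<open>K\<close>. An extremal point is the image
  under a cell map of a point that is no more extreme, which compares the extremum with the fixed
  point of the first or last cell.\<close>

lemma K_unit: "K \<subseteq> cbox 0 1"
proof -
  have "0 \<le> x $ k \<and> x $ k \<le> 1" if "x \<in> K" for x k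
  proof
    have c: "continuous_on K (\<lambda>x. x $ k)" by (intro continuous_intros)
    obtain z where z: "z \<in> K" "\<And>y. y \<in> K \<Longrightarrow> y $ k \<le> z $ k"
      using continuous_attains_sup[OF K_compact K_ne c] by blast
    obtain i y where iy: "i \<in> S" "y \<in> K" "z = cell_map l i y" using cellE[OF z(1)] .
    have "real (i $ k) \<le> real (l - 1)" using index_less[OF iy(1), of k] by simp
    then have "z $ k \<le> (real (l - 1) + z $ k) / real l"
      using z(2)[OF iy(2)] by (subst (1) iy(3)) (simp add: cell_map_nth divide_right_mono)
    then show "x $ k \<le> 1" using contraction_le z(2)[OF that] by fastforce
    obtain z where z: "z \<in> K" "\<And>y. y \<in> K \<Longrightarrow> z $ k \<le> y $ k"
      using continuous_attains_inf[OF K_compact K_ne c] by blast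
    obtain i y where iy: "i \<in> S" "y \<in> K" "z = cell_map l i y" using cellE[OF z(1)] .
    have "z $ k / real l \<le> z $ k"
      using z(2)[OF iy(2)] by (subst (2) iy(3)) (simp add: cell_map_nth divide_right_mono)
    then have "z $ k \<le> real l * z $ k" using l_pos by (simp add: field_simps)
    then have "0 \<le> (real l - 1) * z $ k" by (simp add: algebra_simps)
    then have "0 \<le> z $ k" using l_ge by (simp add: zero_le_mult_iff)
    then show "0 \<le> x $ k" using z(2)[OF that] by simp
  qed
  then show ?thesis by (auto simp: mem_unit_cube)
qed

text \<open>Takes the place of an appeal to uniqueness of the self-similar set: the largest distance
  from \<open>g x\<close> to \<open>K\<close> is at most \<open>1 / l\<close> times itself, hence 0.
  The map \<open>h\<close> is the action of \<open>g\<close> on cell indices.\<close>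

lemma invariant_under:
  assumes g: "g \<in> cube_isometries"
    and conj: "\<And>i x. i \<in> S \<Longrightarrow> h i \<in> S \<and> g (cell_map l i x) = cell_map l (h i) (g x)"
    and x: "x \<in> K"
  shows "g x \<in> K"
proof -
  have dist_g: "dist (g x) (g y) = dist x y" for x y using g by (auto simp: cube_isometries_def)
  then have "continuous_on K g" unfolding continuous_on_iff by auto
  then have "continuous_on K (\<lambda>x. infdist (g x) K)" by (intro continuous_intros)
  then obtain z where z: "z \<in> K" "\<And>y. y \<in> K \<Longrightarrow> infdist (g y) K \<le> infdist (g z) K"
    using continuous_attains_sup[OF K_compact K_ne] by blast
  obtain i y where iy: "i \<in> S" "y \<in> K" "z = cell_map l i y" using cellE[OF z(1)] .
  obtain p where p: "p \<in> K" "infdist (g y) K = dist (g y) p"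
    using infdist_attains_inf[OF compact_imp_closed[OF K_compact] K_ne] by blast
  have "infdist (g z) K \<le> dist (g z) (cell_map l (h i) p)"
    using conj[OF iy(1)] cell_in p(1) by (intro infdist_le) auto
  also have "\<dots> = dist (g y) p / real l"
    using conj[OF iy(1), of y] iy(3) by (simp add: dist_cell_map)
  also have "\<dots> \<le> infdist (g z) K / real l" 
    using z(2)[OF iy(2)] p(2) by (intro divide_right_mono) auto
  finally have "real l * infdist (g z) K \<le> infdist (g z) K" using l_pos by (simp add: field_simps)
  then have "(real l - 1) * infdist (g z) K \<le> 0" by (simp add: algebra_simps)
  then have "infdist (g z) K \<le> 0" using l_ge by (simp add: mult_le_0_iff)
  then have "infdist (g x) K = 0" using z(2)[OF x] infdist_nonneg[of "g x" K] by linarith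
  then show ?thesis using in_closed_iff_infdist_zero[OF compact_imp_closed[OF K_compact] K_ne] by blast
qed

text \<open>\<open>GSC1\<close> speaks about the union of the cells, not about single cells. But the
  centre of a cell lies in no other cell, so it suffices to follow centres.\<close>

lemma index_invariant:
  assumes g: "g \<in> cube_isometries" and gsc: "GSC1 l S"
    and fix_centre: "g (\<chi> k. 1/2) = (\<chi> k. 1/2)"
    and i: "i \<in> S" and conj: "\<And>x. g (cell_map l i x) = cell_map l (h i) (g x)"
  shows "h i \<in> S"
proof -
  let ?c = "(\<chi> k. 1/2) :: real^'n"
  have "cell_map l i ?c \<in> first_level l S"
    using i by (auto simp: first_level_def mem_unit_cube intro!: bexI[of _ i] imageI)
  then have "g (cell_map l i ?c) \<in> first_level l S"
    using gsc g unfolding GSC1_def by blast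
  then obtain j y where j: "j \<in> S" "y \<in> cbox 0 1" "cell_map l (h i) ?c = cell_map l j y"
    using conj[of ?c] fix_centre by (auto simp: first_level_def)
  have "h i $ k = j $ k" for k
  proof -
    have "real (h i $ k) + 1/2 = real (j $ k) + y $ k"
      using j(3) l_pos by (auto simp: cell_map_eq_iff)
    moreover have "0 \<le> y $ k" "y $ k \<le> 1" using j(2) by (auto simp: mem_unit_cube)
    ultimately show ?thesis by linarith
  qed
  then have "h i = j" by (simp add: vec_eq_iff)
  then show ?thesis using j(1) by simp
qed

lemma reflect_in:
  assumes "GSC1 l S" "x \<in> K" shows "reflect B x \<in> K"
proof -
  define h where "h i = (\<chi> k. if k \<in> B then l - 1 - i $ k else i $ k)" for i :: "nat^'n"
  have conj: "reflect B (cell_map l i x) = cell_map l (h i) (reflect B x)" if "i \<in> S" for i x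
    using index_less[OF that] l_pos
    by (auto simp: vec_eq_iff reflect_nth cell_map_nth h_def field_simps of_nat_diff Suc_leI
        less_imp_le)
  show ?thesis
    by (rule invariant_under[OF reflect_isometry _ assms(2), of h])
      (use conj index_invariant[OF reflect_isometry assms(1), of B _ h] in
        \<open>auto simp: vec_eq_iff reflect_nth\<close>)
qed

lemma swap_in:
  assumes "GSC1 l S" "x \<in> K" shows "swap a b x \<in> K"
proof -
  have conj: "swap a b (cell_map l i x) = cell_map l (swap a b i) (swap a b x)" for i and x :: "real^'n"
    by (simp add: vec_eq_iff swap_nth cell_map_nth)
  show ?thesis
    by (rule invariant_under[OF swap_isometry _ assms(2), of "swap a b"])
      (use conj index_invariant[OF swap_isometry assms(1), of a b _ "swap a b"] in
        \<open>auto simp: vec_eq_iff swap_nth\<close>)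
qed

end

section \<open>Partitions of unity on the cube\<close>

text \<open>Used for alternating sums over subsets, with \<open>t\<close> toggling the membership of
  one element.\<close>

lemma sum_involution_zero:
  fixes f :: "'a \<Rightarrow> real"
  assumes "\<And>x. x \<in> X \<Longrightarrow> t x \<in> X" "\<And>x. x \<in> X \<Longrightarrow> t (t x) = x" "\<And>x. x \<in> X \<Longrightarrow> f (t x) = - f x"
  shows "sum f X = 0"
proof -
  have "sum f X = (\<Sum>x\<in>X. f (t x))"
    by (rule sum.reindex_bij_witness[of _ t t]) (use assms in auto)
  also have "\<dots> = - sum f X" using assms(3) by (simp add: sum_negf)
  finally show ?thesis by simp
qed

lemma sym_diff_sym_diff: "sym_diff (sym_diff A B) B = A"
  by auto

lemma sym_diff_sym_diff_cancel: "sym_diff (sym_diff A C) (sym_diff B C) = sym_diff A B"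
  by auto

lemma sum_sym_diff: "(\<Sum>B\<in>UNIV. f (sym_diff B C)) = (\<Sum>B\<in>UNIV. f B)"
  by (rule sum.reindex_bij_witness[of _ "\<lambda>B. sym_diff B C" "\<lambda>B. sym_diff B C"]) (auto simp: sym_diff_sym_diff)

lemma minus_one_power_toggle:
  fixes A :: "'a::finite set"
  assumes "k \<notin> A"
  shows "(- 1 :: real) ^ card (sym_diff B {k} - A) = - ((- 1) ^ card (B - A))"
proof (cases "k \<in> B")
  case True
  then have "B - A = insert k (sym_diff B {k} - A)" using assms by auto
  moreover have "k \<notin> sym_diff B {k} - A" using True by auto
  ultimately have "card (B - A) = Suc (card (sym_diff B {k} - A))" by (metis card_insert_disjoint finite)
  then show ?thesis by simp
next
  case False
  then have "sym_diff B {k} - A = insert k (B - A)" using assms by auto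
  moreover have "k \<notin> B - A" using False by auto
  ultimately have "card (sym_diff B {k} - A) = Suc (card (B - A))" by (metis card_insert_disjoint finite)
  then show ?thesis by simp
qed

lemma minus_one_power_toggle2:
  fixes A :: "'a::finite set"
  assumes "k \<in> B"
  shows "(- 1 :: real) ^ card (B - sym_diff A {k}) = - ((- 1) ^ card (B - A))"
proof (cases "k \<in> A")
  case True
  then have "B - sym_diff A {k} = insert k (B - A)" using assms by auto
  moreover have "k \<notin> B - A" using True by auto
  ultimately have "card (B - sym_diff A {k}) = Suc (card (B - A))" by (metis card_insert_disjoint finite)
  then show ?thesis by simp
next
  case False
  then have "B - A = insert k (B - sym_diff A {k})" using assms by auto
  moreover have "k \<notin> B - sym_diff A {k}" using False by auto
  ultimately have "card (B - A) = Suc (card (B - sym_diff A {k}))" by (metis card_insert_disjoint finite)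
  then show ?thesis by simp
qed

definition min_over :: "('n \<Rightarrow> 'a \<Rightarrow> real) \<Rightarrow> 'n set \<Rightarrow> 'a \<Rightarrow> real" where
  "min_over U B x = Min (insert 1 ((\<lambda>k. U k x) ` B))"

text \<open>If the \<open>U k\<close> take values in \<open>[0,1]\<close>, then \<open>min_over U B x\<close> is the length of
  \<open>{t \<in> (0,1). B \<subseteq> {k. t < U k x}}\<close>, and Moebius inversion over \<open>B\<close> makes
  \<open>kuhn U A x\<close> the length of \<open>{t \<in> (0,1). {k. t < U k x} = A}\<close>.\<close>

definition kuhn :: "('n::finite \<Rightarrow> 'a \<Rightarrow> real) \<Rightarrow> 'n set \<Rightarrow> 'a \<Rightarrow> real" where
  "kuhn U A x = (\<Sum>B | A \<subseteq> B. (- 1) ^ card (B - A) * min_over U B x)"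

text \<open>Averaging over the reflections makes \<open>bump U\<close> equivariant under them, which is what
  allows copies on adjacent cells to be glued.\<close>

definition bump :: "('n::finite \<Rightarrow> real^'n \<Rightarrow> real) \<Rightarrow> 'n set \<Rightarrow> real^'n \<Rightarrow> real" where
  "bump U A x = (\<Sum>B\<in>UNIV. 1 / 2 ^ CARD('n) * kuhn U (sym_diff A B) (reflect B x))"

lemma min_over_bounds:
  fixes U :: "'n::finite \<Rightarrow> 'a \<Rightarrow> real"
  assumes "\<And>k. 0 \<le> U k x" shows "0 \<le> min_over U B x" "min_over U B x \<le> 1"
  using assms by (auto simp: min_over_def)

lemma abs_kuhn_le:
  fixes U :: "'n::finite \<Rightarrow> 'a \<Rightarrow> real"
  assumes "\<And>k. 0 \<le> U k x" shows "\<bar>kuhn U A x\<bar> \<le> 2 ^ CARD('n)"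
proof -
  have "\<bar>kuhn U A x\<bar> \<le> (\<Sum>B | A \<subseteq> B. \<bar>(- 1) ^ card (B - A) * min_over U B x\<bar>)"
    unfolding kuhn_def by (rule sum_abs)
  also have "\<dots> \<le> (\<Sum>B | A \<subseteq> B. 1)"
    using min_over_bounds[of U x] assms by (intro sum_mono) (simp add: abs_mult power_abs)
  also have "\<dots> \<le> real (card (UNIV :: 'n set set))"
    using card_mono[of "UNIV :: 'n set set" "{B. A \<subseteq> B}"] by (simp only: sum_constant) simp
  also have "card (UNIV :: 'n set set) = 2 ^ CARD('n)"
    using card_Pow[of "UNIV :: 'n set"] by simp
  finally show ?thesis by simp
qed

lemma kuhn_zero:
  fixes U :: "'n::finite \<Rightarrow> 'a \<Rightarrow> real"
  assumes U: "\<And>k. 0 \<le> U k x" and k: "k \<in> A \<and> U k x = 0 \<or> k \<notin> A \<and> U k x = 1"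
  shows "kuhn U A x = 0"
  using k
proof
  assume k: "k \<in> A \<and> U k x = 0"
  have "min_over U B x = 0" if "A \<subseteq> B" for B
  proof (rule antisym)
    show "min_over U B x \<le> 0"
      unfolding min_over_def using k that by (intro Min_le) (auto intro: image_eqI[of _ _ k])
  qed (rule min_over_bounds(1)[of U x, OF U])
  then show ?thesis by (auto simp: kuhn_def)
next
  assume k: "k \<notin> A \<and> U k x = 1"
  \<comment> \<open>Toggling \<open>k\<close> flips the sign of the coefficient but not the minimum,
    since the value 1 is always among those compared.\<close>
  have "min_over U (sym_diff B {k}) x = min_over U B x" for B
  proof -
    have "insert 1 ((\<lambda>k. U k x) ` (sym_diff B {k})) = insert 1 ((\<lambda>k. U k x) ` B)"
      using k by (auto intro: image_eqI[of _ _ k])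
    then show ?thesis by (simp add: min_over_def)
  qed
  then show ?thesis unfolding kuhn_def
    by (intro sum_involution_zero[of _ "\<lambda>B. sym_diff B {k}"])
      (use k in \<open>auto simp: minus_one_power_toggle\<close>)
qed

text \<open>After the sums are exchanged, toggling an element of \<open>B\<close> in
  \<open>A\<close> cancels everything except \<open>B = {}\<close>, where the minimum is 1.\<close>

lemma sum_kuhn:
  fixes U :: "'n::finite \<Rightarrow> 'a \<Rightarrow> real"
  shows "(\<Sum>A\<in>UNIV. kuhn U A x) = (1 :: real)"
proof -
  have "(\<Sum>A\<in>UNIV. kuhn U A x) = (\<Sum>A\<in>UNIV. \<Sum>B\<in>UNIV. if A \<subseteq> B then (- 1) ^ card (B - A) * min_over U B x else 0)"
    by (simp add: kuhn_def sum.If_cases)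
  also have "\<dots> = (\<Sum>B\<in>UNIV. \<Sum>A\<in>UNIV. if A \<subseteq> B then (- 1) ^ card (B - A) * min_over U B x else 0)"
    by (rule sum.swap)
  also have "\<dots> = (\<Sum>B\<in>(UNIV :: 'n set set). if B = {} then 1 else 0)"
  proof (rule sum.cong[OF refl])
    fix B :: "'n set"
    show "(\<Sum>A\<in>UNIV. if A \<subseteq> B then (- 1) ^ card (B - A) * min_over U B x else 0) =
      (if B = {} then 1 else 0)"
    proof (cases "B = {}")
      case True then show ?thesis by (simp add: sum.If_cases min_over_def)
    next
      case False
      then obtain k where k: "k \<in> B" by auto
      then have eq: "sym_diff A {k} \<subseteq> B \<longleftrightarrow> A \<subseteq> B" for A by auto
      have "(\<Sum>A\<in>UNIV. if A \<subseteq> B then (- 1) ^ card (B - A) * min_over U B x else 0) = 0"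
        by (rule sum_involution_zero[of _ "\<lambda>A. sym_diff A {k}"])
          (simp_all only: sym_diff_sym_diff eq minus_one_power_toggle2[OF k], auto)
      then show ?thesis using False by simp
    qed
  qed
  also have "\<dots> = 1" by (simp add: sum.If_cases)
  finally show ?thesis .
qed

text \<open>Substituting \<open>sym_diff B C\<close> for \<open>B\<close> only permutes the summands
  of the average over reflections.\<close>

lemma bump_reflect: "bump U A (reflect C x) = bump U (sym_diff A C) x"
proof -
  have "bump U (sym_diff A C) x = (\<Sum>B\<in>UNIV. 1 / 2 ^ CARD('a) *
      kuhn U (sym_diff (sym_diff A C) (sym_diff B C)) (reflect (sym_diff B C) x))"
    unfolding bump_def by (rule sum_sym_diff[symmetric])
  then show ?thesis
    by (simp only: sym_diff_sym_diff_cancel) (simp add: bump_def reflect_reflect)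
qed

lemma sum_bump: "(\<Sum>A\<in>UNIV. bump U A x) = 1"
proof -
  have "(\<Sum>A\<in>UNIV. bump U A x) =
      (\<Sum>B\<in>UNIV. \<Sum>A\<in>UNIV. 1 / 2 ^ CARD('a) * kuhn U (sym_diff A B) (reflect B x))"
    unfolding bump_def by (rule sum.swap)
  also have "\<dots> = (\<Sum>B\<in>(UNIV :: 'a set set). 1 / 2 ^ CARD('a))"
    by (simp add: sum_sym_diff[of "\<lambda>A. kuhn U A (reflect _ x)"] sum_kuhn
        flip: sum_divide_distrib)
  also have "\<dots> = 1"
    using card_Pow[of "UNIV :: 'a set"] by simp
  finally show ?thesis .
qed

text \<open>Reflections exchange the corners of the cube; transpositions turn a function crossing in
  one direction into one crossing in any other, with the same energy.\<close>

locale cube_form = markov_form K D E for K :: "(real^'n) set" and D E +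
  assumes K_unit: "K \<subseteq> cbox 0 1"
    and reflect_K: "x \<in> K \<Longrightarrow> reflect B x \<in> K"
    and swap_K: "x \<in> K \<Longrightarrow> swap a b x \<in> K"
    and reflect_D: "u \<in> D \<Longrightarrow> (\<lambda>x. u (reflect B x)) \<in> D"
    and swap_D: "u \<in> D \<Longrightarrow> (\<lambda>x. u (swap a b x)) \<in> D"
    and Q_reflect: "u \<in> D \<Longrightarrow> E (\<lambda>x. u (reflect B x)) (\<lambda>x. u (reflect B x)) = E u u"
    and Q_swap: "u \<in> D \<Longrightarrow> E (\<lambda>x. u (swap a b x)) (\<lambda>x. u (swap a b x)) = E u u"
begin

text \<open>Polarisation: the symmetry of the form is assumed on the diagonal only.\<close>

lemma E_reflect:
  assumes u: "u \<in> D" and v: "v \<in> D"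
  shows "E (\<lambda>x. u (reflect B x)) (\<lambda>x. v (reflect B x)) = E u v"
  using Q_reflect[OF add[OF u v], of B] Q_add[OF u v] Q_add[OF reflect_D[OF u] reflect_D[OF v], of B B]
    Q_reflect[OF u, of B] Q_reflect[OF v, of B]
  by simp

text \<open>The competitors for the energy between the two faces orthogonal to \<open>k\<close>. The
  bounds 0 and 1 keep the bumps bounded; clamping restores them without raising the energy.\<close>

definition crossing :: "'n \<Rightarrow> (real^'n \<Rightarrow> real) set" where
  "crossing k = {u \<in> D. (\<forall>x\<in>K. 0 \<le> u x \<and> u x \<le> 1) \<and>
    (\<forall>x\<in>K. x $ k = 0 \<longrightarrow> u x = 0) \<and> (\<forall>x\<in>K. x $ k = 1 \<longrightarrow> u x = 1)}"

lemma crossingD: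
  assumes "u \<in> crossing k"
  shows "u \<in> D" "x \<in> K \<Longrightarrow> 0 \<le> u x" "x \<in> K \<Longrightarrow> u x \<le> 1"
    "x \<in> K \<Longrightarrow> x $ k = 0 \<Longrightarrow> u x = 0" "x \<in> K \<Longrightarrow> x $ k = 1 \<Longrightarrow> u x = 1"
  using assms by (auto simp: crossing_def)

lemma crossing_swap:
  assumes "u \<in> crossing k" shows "(\<lambda>x. u (swap k j x)) \<in> crossing j"
  using crossingD[OF assms] swap_K by (auto simp: crossing_def swap_D swap_nth)

lemma min_over_D:
  fixes c :: real
  assumes U: "\<And>k. U k \<in> crossing k" and c: "\<And>k. Q (U k) \<le> c"
  shows "(\<lambda>x. min_over U B x) \<in> D \<and> Q (\<lambda>x. min_over U B x) \<le> card B * c"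
  using finite[of B]
proof (induction B rule: finite_induct)
  case empty
  then show ?case using one E_one by (simp add: min_over_def)
next
  case (insert k B)
  have "min_over U (insert k B) x = min (U k x) (min_over U B x)" for x
    by (simp add: min_over_def insert_commute[of 1])
  then have eq: "(\<lambda>x. min_over U (insert k B) x) = (\<lambda>x. min (U k x) (min_over U B x))" by simp
  show ?case unfolding eq
    using min_D[OF crossingD(1)[OF U[of k]]] insert c[of k] 
    by (fastforce simp: algebra_simps)
qed

lemma kuhn_D:
  fixes c :: real
  assumes U: "\<And>k. U k \<in> crossing k" and c: "\<And>k. Q (U k) \<le> c"
  shows "(\<lambda>x. kuhn U A x) \<in> D"
    and "Q (\<lambda>x. kuhn U A x) \<le> 4 ^ CARD('n) * CARD('n) * c"
proof -
  have c0: "c \<ge> 0" using c E_nonneg[OF crossingD(1)[OF U]] order_trans by blast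
  have D: "(\<lambda>x. (- 1) ^ card (B - A) * min_over U B x) \<in> D" for B
    using min_over_D[OF U c] by (intro scale) auto
  show "(\<lambda>x. kuhn U A x) \<in> D" unfolding kuhn_def by (intro sum_D D)
  have card_le: "card {B. A \<subseteq> B} \<le> 2 ^ CARD('n)"
    using card_mono[of "UNIV :: 'n set set" "{B. A \<subseteq> B}"] card_Pow[of "UNIV :: 'n set"] by simp
  have Q_le: "Q (\<lambda>x. (- 1) ^ card (B - A) * min_over U B x) \<le> CARD('n) * c" for B
  proof -
    have "Q (\<lambda>x. (- 1) ^ card (B - A) * min_over U B x) = Q (\<lambda>x. min_over U B x)"
      using min_over_D[OF U c, of B] by (simp add: Q_scale flip: power_mult)
    also have "\<dots> \<le> card B * c" using min_over_D[OF U c] by blast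
    also have "\<dots> \<le> CARD('n) * c" using c0 by (intro mult_right_mono) (auto intro: card_mono)
    finally show ?thesis .
  qed
  have "Q (\<lambda>x. kuhn U A x) \<le> card {B. A \<subseteq> B} * (\<Sum>B | A \<subseteq> B. Q (\<lambda>x. (- 1) ^ card (B - A) * min_over U B x))"
    unfolding kuhn_def by (rule Q_sum_le) (rule D)
  also have "\<dots> \<le> card {B. A \<subseteq> B} * (\<Sum>B | A \<subseteq> B. CARD('n) * c)"
    by (intro mult_left_mono sum_mono Q_le) auto
  also have "\<dots> = card {B. A \<subseteq> B} * (card {B. A \<subseteq> B} * (CARD('n) * c))" by simp
  also have "\<dots> \<le> 2 ^ CARD('n) * (2 ^ CARD('n) * (CARD('n) * c))"
    using card_le c0 of_nat_mono[OF card_le, where 'a = real] by (intro mult_mono) auto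
  also have "\<dots> = 4 ^ CARD('n) * CARD('n) * c"
    by (simp flip: power_mult_distrib)
  finally show "Q (\<lambda>x. kuhn U A x) \<le> 4 ^ CARD('n) * CARD('n) * c" .
qed

text \<open>The average over \<open>N\<close> reflections does not worsen the bound for
  \<open>kuhn\<close>: the weight \<open>1 / N\<close> enters squared and cancels both factors
  \<open>N\<close>.\<close>

lemma bump_D:
  fixes c :: real
  assumes U: "\<And>k. U k \<in> crossing k" and c: "\<And>k. Q (U k) \<le> c"
  shows "bump U A \<in> D"
    and "Q (bump U A) \<le> 4 ^ CARD('n) * CARD('n) * c"
proof -
  define N :: real where "N = 2 ^ CARD('n)"
  have N: "N > 0" "real (card (UNIV :: 'n set set)) = N"
    using card_Pow[of "UNIV :: 'n set"] by (auto simp: N_def)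
  have eq: "bump U A = (\<lambda>x. \<Sum>B\<in>UNIV. 1 / N * kuhn U (sym_diff A B) (reflect B x))"
    by (simp add: bump_def fun_eq_iff N_def)
  have D': "(\<lambda>x. kuhn U (sym_diff A B) (reflect B x)) \<in> D" for B
    by (rule reflect_D[of "\<lambda>x. kuhn U (sym_diff A B) x"]) (rule kuhn_D(1)[OF U c])
  have D: "(\<lambda>x. 1 / N * kuhn U (sym_diff A B) (reflect B x)) \<in> D" for B
    by (rule scale[OF D'])
  show "bump U A \<in> D" unfolding eq by (intro sum_D D)
  have "Q (bump U A) \<le> N * (\<Sum>B\<in>UNIV. Q (\<lambda>x. 1 / N * kuhn U (sym_diff A B) (reflect B x)))"
    unfolding eq using Q_sum_le[where I = UNIV and f = "\<lambda>B x. 1 / N * kuhn U (sym_diff A B) (reflect B x)", OF D] N by simp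
  also have "\<dots> \<le> N * (\<Sum>B\<in>(UNIV :: 'n set set). (1 / N)\<^sup>2 * (4 ^ CARD('n) * CARD('n) * c))"
  proof (intro mult_left_mono sum_mono)
    fix B :: "'n set"
    have "Q (\<lambda>x. 1 / N * kuhn U (sym_diff A B) (reflect B x)) =
        (1 / N)\<^sup>2 * Q (\<lambda>x. kuhn U (sym_diff A B) x)"
      by (subst Q_scale[OF D'], subst Q_reflect[of "\<lambda>x. kuhn U (sym_diff A B) x"])
        (rule kuhn_D(1)[OF U c], rule refl)
    also have "\<dots> \<le> (1 / N)\<^sup>2 * (4 ^ CARD('n) * CARD('n) * c)"
      by (intro mult_left_mono kuhn_D[OF U c]) auto
    finally show "Q (\<lambda>x. 1 / N * kuhn U (sym_diff A B) (reflect B x)) \<le>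
      (1 / N)\<^sup>2 * (4 ^ CARD('n) * CARD('n) * c)" .
  qed (use N in auto)
  also have "\<dots> = 4 ^ CARD('n) * CARD('n) * c"
    using N by (simp add: power2_eq_square)
  finally show "Q (bump U A) \<le> 4 ^ CARD('n) * CARD('n) * c" .
qed

lemma abs_bump_le:
  fixes U :: "'n \<Rightarrow> real^'n \<Rightarrow> real"
  assumes U: "\<And>k. U k \<in> crossing k" and x: "x \<in> K"
  shows "\<bar>bump U A x\<bar> \<le> 2 ^ CARD('n)"
proof -
  define N :: real where "N = 2 ^ CARD('n)"
  have N: "N > 0" "real (card (UNIV :: 'n set set)) = N"
    using card_Pow[of "UNIV :: 'n set"] by (auto simp: N_def)
  have "\<bar>bump U A x\<bar> \<le> (\<Sum>B\<in>UNIV. \<bar>1 / N * kuhn U (sym_diff A B) (reflect B x)\<bar>)"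
    unfolding bump_def N_def by (rule sum_abs)
  also have "\<dots> \<le> (\<Sum>B\<in>(UNIV :: 'n set set). 1 / N * N)"
  proof (intro sum_mono)
    fix B :: "'n set"
    have "\<bar>kuhn U (sym_diff A B) (reflect B x)\<bar> \<le> N"
      unfolding N_def using crossingD(2)[OF U reflect_K[OF x]] by (intro abs_kuhn_le)
    then show "\<bar>1 / N * kuhn U (sym_diff A B) (reflect B x)\<bar> \<le> 1 / N * N"
      using N by (simp add: abs_mult field_simps)
  qed
  also have "\<dots> = 2 ^ CARD('n)" using N by (simp add: N_def)
  finally show ?thesis .
qed

text \<open>The set \<open>A\<close> stands for the corner whose coordinates in \<open>A\<close> are
  1 and the others 0. Its bump vanishes on the faces that do not contain it; each reflection in the
  average moves face and corner together.\<close>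

lemma bump_zero:
  fixes U :: "'n \<Rightarrow> real^'n \<Rightarrow> real"
  assumes U: "\<And>k. U k \<in> crossing k" and x: "x \<in> K"
    and k: "k \<in> A \<and> x $ k = 0 \<or> k \<notin> A \<and> x $ k = 1"
  shows "bump U A x = 0"
proof -
  have "kuhn U (sym_diff A B) (reflect B x) = 0" for B
  proof (rule kuhn_zero[where k = k])
    show "0 \<le> U j (reflect B x)" for j using crossingD(2)[OF U reflect_K[OF x]] .
    show "k \<in> sym_diff A B \<and> U k (reflect B x) = 0 \<or> k \<notin> sym_diff A B \<and> U k (reflect B x) = 1"
      using k crossingD(4,5)[OF U[of k] reflect_K[OF x, of B]]
      by (cases "k \<in> B") (auto simp: reflect_nth)
  qed
  then show ?thesis by (simp add: bump_def)
qed

end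

section \<open>Pasting and interpolation\<close>

text \<open>Coordinates of the corner \<open>A\<close> of the cell \<open>i\<close>, in units of
  \<open>1 / l\<close>.\<close>

definition shift :: "nat^'n \<Rightarrow> 'n set \<Rightarrow> nat^'n" where
  "shift i A = (\<chi> k. i $ k + (if k \<in> A then 1 else 0))"

lemma shift_nth: "shift i A $ k = i $ k + (if k \<in> A then 1 else 0)"
  by (simp add: shift_def)

text \<open>Two offsets in \<open>[0,1]\<close> can compensate a difference of integers only if it
  is 0 or, with the offsets at opposite ends, 1.\<close>

lemma cell_overlap:
  fixes y z :: "real^'n"
  assumes "l > 0" "cell_map l i y = cell_map l j z" "y \<in> cbox 0 1" "z \<in> cbox 0 1"
  shows "i $ k = j $ k \<and> y $ k = z $ k \<or> i $ k = Suc (j $ k) \<and> y $ k = 0 \<and> z $ k = 1 \<or>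
    j $ k = Suc (i $ k) \<and> y $ k = 1 \<and> z $ k = 0"
proof -
  have "real (i $ k) + y $ k = real (j $ k) + z $ k"
    using assms(1,2) by (simp add: cell_map_eq_iff)
  moreover have "0 \<le> y $ k" "y $ k \<le> 1" "0 \<le> z $ k" "z $ k \<le> 1"
    using assms(3,4) by (auto simp: mem_unit_cube)
  moreover have "i $ k = j $ k \<or> real (i $ k) \<ge> real (j $ k) + 1 \<or> real (j $ k) \<ge> real (i $ k) + 1"
    by linarith
  ultimately have "i $ k = j $ k \<and> y $ k = z $ k \<or>
      real (i $ k) = real (j $ k) + 1 \<and> y $ k = 0 \<and> z $ k = 1 \<or>
      real (j $ k) = real (i $ k) + 1 \<and> y $ k = 1 \<and> z $ k = 0"
    by (elim disjE) (simp, linarith+)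
  moreover have "real a = real b + 1 \<longleftrightarrow> a = Suc b" for a b by linarith
  ultimately show ?thesis by (simp only:)
qed

text \<open>The symmetries are those of \<open>K\<close> and the form, so a level consists just of
  \<open>l\<close>, \<open>S\<close> and \<open>r\<close>. Iterated subdivisions for the same form
  are then further instances.\<close>

locale carpet_level = cube_form K D E + self_similar l S K
  for K :: "(real^'n) set" and D E and l :: nat and S +
  fixes r :: real
  assumes r_pos: "r > 0"
    and paste: "continuous_on K u \<Longrightarrow> (\<And>i. i \<in> S \<Longrightarrow> (\<lambda>x. u (cell_map l i x)) \<in> D) \<Longrightarrow> u \<in> D"
    and restrict: "u \<in> D \<Longrightarrow> i \<in> S \<Longrightarrow> (\<lambda>x. u (cell_map l i x)) \<in> D"
    and Q_self_similar:
      "u \<in> D \<Longrightarrow> E u u = (\<Sum>i\<in>S. E (\<lambda>x. u (cell_map l i x)) (\<lambda>x. u (cell_map l i x))) / r"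
begin

lemma E_self_similar:
  assumes u: "u \<in> D" and v: "v \<in> D"
  shows "E u v = (\<Sum>i\<in>S. E (\<lambda>x. u (cell_map l i x)) (\<lambda>x. v (cell_map l i x))) / r"
proof -
  have "2 * E u v = Q (\<lambda>x. u x + v x) - Q u - Q v" using Q_add[OF u v] by simp
  also have "\<dots> = (\<Sum>i\<in>S. Q (\<lambda>x. u (cell_map l i x) + v (cell_map l i x)) -
      Q (\<lambda>x. u (cell_map l i x)) - Q (\<lambda>x. v (cell_map l i x))) / r"
    using Q_self_similar[OF add[OF u v]] Q_self_similar[OF u] Q_self_similar[OF v]
    by (simp add: sum_subtractf diff_divide_distrib)
  also have "\<dots> = (\<Sum>i\<in>S. 2 * E (\<lambda>x. u (cell_map l i x)) (\<lambda>x. v (cell_map l i x))) / r"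
    using Q_add[OF restrict[OF u] restrict[OF v]] by (intro arg_cong2[where f = "(/)"] sum.cong) auto
  finally show ?thesis by (simp add: sum_distrib_left[symmetric])
qed

text \<open>Compatibility makes the values at shared points independent of the chosen cell, and
  continuity holds because finitely many closed cells cover \<open>K\<close>.\<close>

lemma pasting:
  assumes p: "\<And>i. i \<in> S \<Longrightarrow> p i \<in> D"
    and compat: "\<And>i j y z. i \<in> S \<Longrightarrow> j \<in> S \<Longrightarrow> y \<in> K \<Longrightarrow> z \<in> K \<Longrightarrow>
      cell_map l i y = cell_map l j z \<Longrightarrow> p i y = p j z"
  obtains u where "u \<in> D" "\<And>i y. i \<in> S \<Longrightarrow> y \<in> K \<Longrightarrow> u (cell_map l i y) = p i y"
proof -
  define u where "u x = (SOME t. \<exists>i\<in>S. \<exists>y\<in>K. x = cell_map l i y \<and> t = p i y)" for x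
  have u: "u (cell_map l i y) = p i y" if "i \<in> S" "y \<in> K" for i y
    unfolding u_def
  proof (rule some_equality)
    show "\<exists>j\<in>S. \<exists>z\<in>K. cell_map l i y = cell_map l j z \<and> p i y = p j z"
      using that by blast
    show "t = p i y" if "\<exists>j\<in>S. \<exists>z\<in>K. cell_map l i y = cell_map l j z \<and> t = p j z" for t
      using that compat[OF \<open>i \<in> S\<close> _ \<open>y \<in> K\<close>] by auto
  qed
  have "continuous_on (cell_map l i ` K) u" if i: "i \<in> S" for i
  proof -
    define g where "g x = (\<chi> k. real l * x $ k - real (i $ k))" for x :: "real^'n"
    have g: "g (cell_map l i y) = y" for y
      using l_pos by (simp add: g_def vec_eq_iff cell_map_nth)
    have "continuous_on (cell_map l i ` K) (p i \<circ> g)"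
    proof (rule continuous_on_compose)
      show "continuous_on (cell_map l i ` K) g" unfolding g_def by (intro continuous_intros)
      have "g ` cell_map l i ` K = K" by (simp add: image_image g)
      then show "continuous_on (g ` cell_map l i ` K) (p i)" using cont[OF p[OF i]] by simp
    qed
    then show ?thesis
      by (rule continuous_on_eq) (use u i g in auto)
  qed
  moreover have "closed (cell_map l i ` K)" for i
    by (intro compact_imp_closed compact_continuous_image continuous_cell_map K_compact)
  ultimately have "continuous_on (\<Union>i\<in>S. cell_map l i ` K) u"
    by (intro continuous_on_closed_Union S_finite)
  then have "continuous_on K u" using K_eq by simp
  then have "u \<in> D"
    by (rule paste) (use p u in \<open>blast intro: D_cong\<close>)
  then show ?thesis using that u by blast
qed

lemma interpolation:
  assumes U: "\<And>k. U k \<in> crossing k"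
  obtains u where "u \<in> D" "\<And>i y. i \<in> S \<Longrightarrow> y \<in> K \<Longrightarrow>
    u (cell_map l i y) = (\<Sum>A\<in>UNIV. q (shift i A) * bump U A y)"
\<comment> \<open>\<open>bump_D\<close> asks for one energy bound for all directions; the maximum
  over the finitely many directions serves.\<close>
proof -
  have D: "bump U A \<in> D" for A
    by (rule bump_D(1)[OF U Max_ge[of "range (\<lambda>k. Q (U k))"]]) auto
  show thesis
  proof (rule pasting[of "\<lambda>i y. \<Sum>A\<in>UNIV. q (shift i A) * bump U A y"])
    show "(\<lambda>y. \<Sum>A\<in>UNIV. q (shift i A) * bump U A y) \<in> D" for i
      by (intro sum_D scale D)
    fix i j y z
    assume ij: "i \<in> S" "j \<in> S" and yz: "y \<in> K" "z \<in> K" "cell_map l i y = cell_map l j z"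
    have cases: "i $ k = j $ k \<and> y $ k = z $ k \<or> i $ k = Suc (j $ k) \<and> y $ k = 0 \<and> z $ k = 1 \<or>
      j $ k = Suc (i $ k) \<and> y $ k = 1 \<and> z $ k = 0" for k
      using cell_overlap[OF l_pos yz(3)] yz(1,2) K_unit by blast
    define B where "B = {k. i $ k \<noteq> j $ k}"
    have z: "z = reflect B y" unfolding vec_eq_iff
    proof
      show "z $ k = reflect B y $ k" for k
        using cases[of k] by (auto simp: B_def reflect_nth)
    qed
    have "q (shift i A) * bump U A y = q (shift j (sym_diff A B)) * bump U A y" for A
    \<comment> \<open>The condition says that the corner \<open>A\<close> of the cell
      \<open>i\<close> lies on the face shared with the cell \<open>j\<close>. Then it is the corner
      \<open>sym_diff A B\<close> of \<open>j\<close>; otherwise its bump vanishes at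
      \<open>y\<close>.\<close>
    proof (cases "\<forall>k. (i $ k = Suc (j $ k) \<longrightarrow> k \<notin> A) \<and> (j $ k = Suc (i $ k) \<longrightarrow> k \<in> A)")
      case True
      have "shift i A = shift j (sym_diff A B)" unfolding vec_eq_iff
      proof
        show "shift i A $ k = shift j (sym_diff A B) $ k" for k
          using cases[of k] True[rule_format, of k] by (auto simp: B_def shift_nth)
      qed
      then show ?thesis by simp
    next
      case False
      then obtain k where "i $ k = Suc (j $ k) \<and> k \<in> A \<or> j $ k = Suc (i $ k) \<and> k \<notin> A"
        by blast
      then have "k \<in> A \<and> y $ k = 0 \<or> k \<notin> A \<and> y $ k = 1"
        using cases[of k] by auto
      then show ?thesis using bump_zero[OF U yz(1)] by simp
    qed
    then have "(\<Sum>A\<in>UNIV. q (shift i A) * bump U A y) =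
        (\<Sum>A\<in>UNIV. q (shift j (sym_diff A B)) * bump U A y)"
      by (rule sum.cong[OF refl])
    also have "\<dots> = (\<Sum>A\<in>UNIV. q (shift j (sym_diff (sym_diff A B) B)) * bump U (sym_diff A B) y)"
      by (rule sum_sym_diff[symmetric])
    also have "\<dots> = (\<Sum>A\<in>UNIV. q (shift j A) * bump U A z)"
      by (simp only: sym_diff_sym_diff z bump_reflect)
    finally show "(\<Sum>A\<in>UNIV. q (shift i A) * bump U A y) = (\<Sum>A\<in>UNIV. q (shift j A) * bump U A z)" .
  qed (use that in blast)
qed

lemma dist_grid_point:
  assumes "y \<in> K"
  shows "dist (cell_map l i y) (\<chi> k. real (shift i A $ k) / real l) \<le> real CARD('n) / real l"
proof -
  have "norm (cell_map l i y - (\<chi> k. real (shift i A $ k) / real l)) \<le>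
      (\<Sum>k\<in>UNIV. \<bar>(cell_map l i y - (\<chi> k. real (shift i A $ k) / real l)) $ k\<bar>)"
    by (rule norm_le_l1_cart)
  also have "\<dots> \<le> (\<Sum>k\<in>(UNIV :: 'n set). 1 / real l)"
  proof (rule sum_mono)
    fix k
    have "0 \<le> y $ k" "y $ k \<le> 1" using assms K_unit by (auto simp: mem_unit_cube)
    then have "\<bar>y $ k - (if k \<in> A then 1 else 0)\<bar> \<le> 1" by auto
    moreover have "(cell_map l i y - (\<chi> k. real (shift i A $ k) / real l)) $ k =
      (y $ k - (if k \<in> A then 1 else 0)) / real l"
      by (simp add: cell_map_nth shift_nth diff_divide_distrib add_divide_distrib)
    ultimately show "\<bar>(cell_map l i y - (\<chi> k. real (shift i A $ k) / real l)) $ k\<bar> \<le> 1 / real l"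
      by (simp add: divide_right_mono)
  qed
  finally show ?thesis by (simp add: dist_norm)
qed

text \<open>The function \<open>f\<close> lives on the cube because grid points may lie outside
  \<open>K\<close>. The error sums \<eta> over \<open>2 ^ CARD('n)\<close> corners, with bumps of
  modulus at most \<open>2 ^ CARD('n)\<close>. In the energy, one factor \<open>4 ^ CARD('n)\<close>
  comes from the sum over corners and one from \<open>bump_D\<close>. The bound depends on the level
  through \<open>card S / r\<close>.\<close>

lemma interpolation_estimate:
  fixes c M \<eta> :: real
  assumes U: "\<And>k. U k \<in> crossing k" and c: "\<And>k. Q (U k) \<le> c"
    and M: "\<And>x. x \<in> cbox 0 1 \<Longrightarrow> \<bar>f x\<bar> \<le> M"
    and \<eta>: "\<And>x y. x \<in> cbox 0 1 \<Longrightarrow> y \<in> cbox 0 1 \<Longrightarrow> dist x y \<le> real CARD('n) / real l \<Longrightarrow>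
      \<bar>f x - f y\<bar> \<le> \<eta>"
  obtains u where "u \<in> D" "\<And>x. x \<in> K \<Longrightarrow> \<bar>u x - f x\<bar> \<le> 4 ^ CARD('n) * \<eta>"
    "Q u \<le> real (card S) / r * (16 ^ CARD('n) * M\<^sup>2 * CARD('n)) * c"
proof -
  define grid where "grid n = (\<chi> k. real (n $ k) / real l)" for n :: "nat^'n"
  define N :: real where "N = 2 ^ CARD('n)"
  have N: "N > 0" "real (card (UNIV :: 'n set set)) = N" "N * N = 4 ^ CARD('n)"
    using card_Pow[of "UNIV :: 'n set"] by (auto simp: N_def simp flip: power_mult_distrib)
  have c0: "c \<ge> 0" using c E_nonneg[OF crossingD(1)[OF U]] order_trans by blast
  have grid: "grid (shift i A) \<in> cbox 0 1" if i: "i \<in> S" for i A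
  proof -
    have "real (shift i A $ k) \<le> real l" for k
      using index_less[OF i, of k] by (simp add: shift_nth)
    then show ?thesis using l_pos by (auto simp: mem_unit_cube grid_def)
  qed
  obtain u where u: "u \<in> D" and u_eq: "\<And>i y. i \<in> S \<Longrightarrow> y \<in> K \<Longrightarrow>
      u (cell_map l i y) = (\<Sum>A\<in>UNIV. f (grid (shift i A)) * bump U A y)"
    using interpolation[OF U, of "\<lambda>n. f (grid n)"] by blast
  show thesis
  proof
    show "u \<in> D" by fact
    show "\<bar>u x - f x\<bar> \<le> 4 ^ CARD('n) * \<eta>" if x: "x \<in> K" for x
    proof -
      obtain i y where iy: "i \<in> S" "y \<in> K" "x = cell_map l i y" using cellE[OF x] .
      have "u x - f x = (\<Sum>A\<in>UNIV. f (grid (shift i A)) * bump U A y) - f x * (\<Sum>A\<in>UNIV. bump U A y)"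
        using u_eq[OF iy(1,2)] iy(3) by (simp add: sum_bump)
      also have "\<dots> = (\<Sum>A\<in>UNIV. (f (grid (shift i A)) - f x) * bump U A y)"
        by (simp add: sum_distrib_left sum_subtractf left_diff_distrib)
      also have "\<bar>\<dots>\<bar> \<le> (\<Sum>A\<in>UNIV. \<bar>(f (grid (shift i A)) - f x) * bump U A y\<bar>)"
        by (rule sum_abs)
      also have "\<dots> \<le> (\<Sum>A\<in>(UNIV :: 'n set set). \<eta> * N)"
      proof (intro sum_mono)
        fix A :: "'n set"
        have "\<bar>f x - f (grid (shift i A))\<bar> \<le> \<eta>"
          using dist_grid_point[OF iy(2), of i A] x K_unit grid[OF iy(1)] iy(3)
          by (intro \<eta>) (auto simp: grid_def)
        then show "\<bar>(f (grid (shift i A)) - f x) * bump U A y\<bar> \<le> \<eta> * N"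
          unfolding abs_mult N_def using abs_bump_le[OF U iy(2), of A] by (intro mult_mono) auto
      qed
      also have "\<dots> = 4 ^ CARD('n) * \<eta>"
        using N by (simp flip: N(3))
      finally show ?thesis .
    qed
    have Q_le: "Q (\<lambda>y. u (cell_map l i y)) \<le> 16 ^ CARD('n) * M\<^sup>2 * CARD('n) * c" if i: "i \<in> S" for i
    proof -
      have D: "bump U A \<in> D" for A by (rule bump_D(1)[OF U c])
      have D': "(\<lambda>y. f (grid (shift i A)) * bump U A y) \<in> D" for A by (rule scale[OF D])
      have "Q (\<lambda>y. u (cell_map l i y)) = Q (\<lambda>y. \<Sum>A\<in>UNIV. f (grid (shift i A)) * bump U A y)"
        by (rule E_cong) (use u_eq[OF i] D' in \<open>auto intro!: sum_D\<close>)
      also have "\<dots> \<le> N * (\<Sum>A\<in>UNIV. Q (\<lambda>y. f (grid (shift i A)) * bump U A y))"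
        using Q_sum_le[where I = UNIV and f = "\<lambda>A y. f (grid (shift i A)) * bump U A y", OF D'] N
        by simp
      also have "\<dots> \<le> N * (\<Sum>A\<in>(UNIV :: 'n set set). M\<^sup>2 * (4 ^ CARD('n) * CARD('n) * c))"
      proof (intro mult_left_mono sum_mono)
        fix A :: "'n set"
        have "(f (grid (shift i A)))\<^sup>2 \<le> M\<^sup>2"
          using M[OF grid[OF i], of A] by (simp flip: abs_le_square_iff)
        then show "Q (\<lambda>y. f (grid (shift i A)) * bump U A y) \<le> M\<^sup>2 * (4 ^ CARD('n) * CARD('n) * c)"
          unfolding Q_scale[OF D] using bump_D(2)[OF U c] E_nonneg[OF D] by (intro mult_mono) auto
      qed (use N in auto)
      also have "\<dots> = N * N * M\<^sup>2 * (4 ^ CARD('n) * CARD('n) * c)"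
        using N by simp
      also have "\<dots> = (4 ^ CARD('n) * 4 ^ CARD('n)) * M\<^sup>2 * CARD('n) * c"
        unfolding N(3) by simp
      finally show ?thesis by (simp flip: power_mult_distrib)
    qed
    have "Q u \<le> (\<Sum>i\<in>S. 16 ^ CARD('n) * M\<^sup>2 * CARD('n) * c) / r"
      unfolding Q_self_similar[OF u] using Q_le r_pos by (intro divide_right_mono sum_mono) auto
    then show "Q u \<le> real (card S) / r * (16 ^ CARD('n) * M\<^sup>2 * CARD('n)) * c"
      by (simp add: mult.assoc)
  qed
qed

end

section \<open>Iterated subdivisions\<close>

lemma cell_map_cell_map:
  assumes "l' > 0"
  shows "cell_map l i (cell_map l' j x) = cell_map (l * l') (\<chi> k. l' * i $ k + j $ k) x"
  using assms by (auto simp: vec_eq_iff cell_map_nth field_simps)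

lemma carpet_level_compose:
  fixes S S' :: "(nat^'n) set"
  assumes "carpet_level K D E l S r" "carpet_level K D E l' S' r'"
  shows "carpet_level K D E (l * l') ((\<lambda>(i, j). \<chi> k. l' * i $ k + j $ k) ` (S \<times> S')) (r * r')"
proof -
  interpret A: carpet_level K D E l S r by fact
  interpret B: carpet_level K D E l' S' r' by fact
  define h where "h = (\<lambda>(i, j). (\<chi> k. l' * i $ k + j $ k) :: nat^'n)"
  have cm: "cell_map (l * l') (h (i, j)) x = cell_map l i (cell_map l' j x)" for i j x
    using B.l_pos by (simp add: cell_map_cell_map h_def)
  \<comment> \<open>Uniqueness of digits to base \<open>l'\<close>, as \<open>j $ k < l'\<close>. It
    turns the double sum of energies into a single sum over the composite indices.\<close>
  have inj: "inj_on h (S \<times> S')"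
  proof (rule inj_onI, clarify)
    fix i j i' j' assume *: "i \<in> S" "j \<in> S'" "i' \<in> S" "j' \<in> S'" "h (i, j) = h (i', j')"
    have "i $ k = i' $ k \<and> j $ k = j' $ k" for k
    proof -
      have "l' * i $ k + j $ k = l' * i' $ k + j' $ k"
        using *(5) by (auto simp: h_def vec_eq_iff)
      moreover have "j $ k < l'" "j' $ k < l'" using * B.index_less by auto
      ultimately show ?thesis
        by (smt (verit, best) mod_mult_self4 mod_less add_right_cancel mult_cancel1 not_less_zero)
    qed
    then show "i = i' \<and> j = j'" by (simp add: vec_eq_iff)
  qed
  have "carpet_level K D E (l * l') (h ` (S \<times> S')) (r * r')"
  proof
    show "2 \<le> l * l'" using A.l_ge B.l_ge mult_le_mono[of 2 l 1 l'] by simp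
    show "i $ k < l * l'" if i: "i \<in> h ` (S \<times> S')" for i k
    proof -
      obtain a b where ab: "a \<in> S" "b \<in> S'" "i = h (a, b)" using i by auto
      have "l' * a $ k + b $ k < l' * a $ k + l'" using B.index_less[OF ab(2)] by simp
      also have "\<dots> = l' * Suc (a $ k)" by simp
      also have "\<dots> \<le> l' * l" using A.index_less[OF ab(1), of k] by (intro mult_le_mono2) simp
      finally show ?thesis using ab(3) by (simp add: h_def mult.commute)
    qed
    show "K = (\<Union>i\<in>h ` (S \<times> S'). cell_map (l * l') i ` K)"
    proof (intro set_eqI iffI)
      fix x assume "x \<in> K"
      then obtain i y where iy: "i \<in> S" "y \<in> K" "x = cell_map l i y" by (rule A.cellE)
      obtain j z where jz: "j \<in> S'" "z \<in> K" "y = cell_map l' j z" using B.cellE[OF iy(2)] .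
      show "x \<in> (\<Union>i\<in>h ` (S \<times> S'). cell_map (l * l') i ` K)"
        unfolding iy(3) jz(3) cm[symmetric] using iy(1) jz(1,2) by blast
    next
      fix x assume "x \<in> (\<Union>i\<in>h ` (S \<times> S'). cell_map (l * l') i ` K)"
      then show "x \<in> K" by (auto simp: cm A.cell_in B.cell_in)
    qed
    show "r * r' > 0" using A.r_pos B.r_pos by simp
    show "u \<in> D" if u: "continuous_on K u"
      "\<And>i. i \<in> h ` (S \<times> S') \<Longrightarrow> (\<lambda>x. u (cell_map (l * l') i x)) \<in> D" for u
    proof (rule A.paste[OF u(1)])
      fix i assume i: "i \<in> S"
      show "(\<lambda>x. u (cell_map l i x)) \<in> D"
      proof (rule B.paste)
        show "continuous_on K (\<lambda>x. u (cell_map l i x))"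
          by (rule continuous_on_compose2[OF u(1) continuous_cell_map]) (use i A.cell_in in auto)
        show "(\<lambda>x. u (cell_map l i (cell_map l' j x))) \<in> D" if "j \<in> S'" for j
          using u(2)[of "h (i, j)"] i that by (simp add: cm)
      qed
    qed
    show "(\<lambda>x. u (cell_map (l * l') i x)) \<in> D" if "u \<in> D" "i \<in> h ` (S \<times> S')" for u i
      using that B.restrict[OF A.restrict] by (auto simp: cm)
    show "E u u = (\<Sum>i\<in>h ` (S \<times> S'). E (\<lambda>x. u (cell_map (l * l') i x))
        (\<lambda>x. u (cell_map (l * l') i x))) / (r * r')" if u: "u \<in> D" for u
    proof -
      define G where "G i j = E (\<lambda>x. u (cell_map l i (cell_map l' j x)))
        (\<lambda>x. u (cell_map l i (cell_map l' j x)))" for i j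
      have "E (\<lambda>x. u (cell_map l i x)) (\<lambda>x. u (cell_map l i x)) = (\<Sum>j\<in>S'. G i j) / r'"
        if "i \<in> S" for i
        unfolding G_def by (rule B.Q_self_similar[OF A.restrict[OF u that]])
      then have "E u u = (\<Sum>i\<in>S. (\<Sum>j\<in>S'. G i j) / r') / r"
        unfolding A.Q_self_similar[OF u] by (intro arg_cong2[where f = "(/)"] sum.cong refl)
      also have "\<dots> = (\<Sum>i\<in>S. \<Sum>j\<in>S'. G i j) / (r * r')"
        by (simp add: mult.commute flip: sum_divide_distrib)
      also have "(\<Sum>i\<in>S. \<Sum>j\<in>S'. G i j) = (\<Sum>p\<in>S \<times> S'. G (fst p) (snd p))"
        by (simp add: sum.cartesian_product split_def)
      also have "\<dots> = (\<Sum>p\<in>S \<times> S'. E (\<lambda>x. u (cell_map (l * l') (h p) x))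
          (\<lambda>x. u (cell_map (l * l') (h p) x)))"
        by (rule sum.cong) (auto simp: cm G_def)
      also have "\<dots> = (\<Sum>i\<in>h ` (S \<times> S'). E (\<lambda>x. u (cell_map (l * l') i x))
          (\<lambda>x. u (cell_map (l * l') i x)))"
        by (simp add: sum.reindex[OF inj])
      finally show ?thesis .
    qed
  qed (use A.K_ne A.K_compact in auto)
  then show ?thesis by (simp add: h_def)
qed

text \<open>Existence of the index set and the factor suffices: when the lemma is applied, the level
  is fixed before the crossing function of small energy is chosen.\<close>

lemma (in carpet_level) carpet_level_power:
  "m \<ge> 1 \<Longrightarrow> \<exists>S' r'. carpet_level K D E (l ^ m) S' r'"
proof (induction m rule: nat_induct_at_least)
  case base
  show ?case using carpet_level_axioms by (intro exI[of _ S] exI[of _ r]) simp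
next
  case (Suc m)
  then obtain S' r' where "carpet_level K D E (l ^ m) S' r'" by blast
  from carpet_level_compose[OF carpet_level_axioms this] show ?case by auto
qed

section \<open>Functions crossing the cube\<close>

text \<open>\<open>dense\<close> is the uniform half of regularity and supplies crossing functions;
  \<open>closed\<close> expresses closedness in terms of uniform limits of continuous
  functions.\<close>

locale carpet_form = carpet_level K D E l S r
  for K :: "(real^'n) set" and D E and l :: nat and S and r :: real +
  assumes dense: "continuous_on K f \<Longrightarrow> e > 0 \<Longrightarrow> \<exists>u\<in>D. \<forall>x\<in>K. \<bar>f x - u x\<bar> < e"
    and closed: "(\<And>n. g n \<in> D) \<Longrightarrow> u \<in> D \<Longrightarrow> uniform_limit K g u sequentially \<Longrightarrow>
      (\<lambda>n. E (g n) (g n)) \<longlonglongrightarrow> 0 \<Longrightarrow> E u u = 0"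
    and nontrivial: "\<exists>u\<in>D. E u u > 0"
begin

lemma crossing_clamp:
  assumes "u \<in> D" "\<And>x. x \<in> K \<Longrightarrow> x $ k = 0 \<Longrightarrow> u x \<le> 0" "\<And>x. x \<in> K \<Longrightarrow> x $ k = 1 \<Longrightarrow> u x \<ge> 1"
  shows "(\<lambda>x. min (max (u x) 0) 1) \<in> crossing k"
proof -
  have "min (max (u x) 0) 1 = 1" if "x \<in> K" "x $ k = 1" for x
    using assms(3)[OF that] by simp
  then show ?thesis using clamp_D(1)[OF assms(1)] assms(2) by (auto simp: crossing_def)
qed

lemma crossing_nonempty: "crossing k \<noteq> {}"
proof -
  \<comment> \<open>The values -1 and 2 on the two faces leave a margin of 1 for the
    approximation.\<close>
  have "continuous_on K (\<lambda>x. 3 * x $ k - 1)" by (intro continuous_intros)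
  from dense[OF this, of 1] obtain u where
    u: "u \<in> D" "\<And>x. x \<in> K \<Longrightarrow> \<bar>3 * x $ k - 1 - u x\<bar> < 1" by auto
  have "u x \<le> 0" if "x \<in> K" "x $ k = 0" for x using u(2)[OF that(1)] that(2) by simp
  moreover have "u x \<ge> 1" if "x \<in> K" "x $ k = 1" for x using u(2)[OF that(1)] that(2) by simp
  ultimately show ?thesis using crossing_clamp[OF u(1), of k] by blast
qed

text \<open>Were there functions of arbitrarily small energy between two opposite faces, then
  interpolation at a fine level would approximate every function in \<open>D\<close> with vanishing energy.\<close>

lemma crossing_energy_pos: "\<exists>e>0. \<forall>u\<in>crossing k. e \<le> Q u"
proof (rule ccontr)
  assume "\<not> ?thesis"
  then have small: "\<exists>u\<in>crossing k. Q u < e" if "e > 0" for e using that by (meson not_le)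
  obtain v where v: "v \<in> D" "Q v > 0" using nontrivial by blast
  have "bounded (v ` K)"
    by (intro compact_imp_bounded compact_continuous_image cont[OF v(1)] K_compact)
  then obtain M where M: "M > 0" "\<And>x. x \<in> K \<Longrightarrow> norm (v x) \<le> M"
    by (auto simp: bounded_pos)
  \<comment> \<open>Interpolation evaluates at grid points, possibly outside \<open>K\<close>, so
    \<open>v\<close> is extended to the cube with the same bound.\<close>
  have "closedin (top_of_set (cbox 0 1)) K"
    using K_compact K_unit by (intro closed_subset compact_imp_closed)
  then obtain f where f: "continuous_on (cbox 0 1) f" "\<And>x. x \<in> K \<Longrightarrow> f x = v x"
      "\<And>x. x \<in> cbox 0 1 \<Longrightarrow> norm (f x) \<le> M"
    using Tietze[OF cont[OF v(1)], of "cbox 0 1" M] M less_imp_le by metis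
  have unif: "uniformly_continuous_on (cbox 0 1) f"
    by (intro compact_uniformly_continuous f(1) compact_cbox)
  have "\<exists>u\<in>D. (\<forall>x\<in>K. \<bar>u x - v x\<bar> \<le> e) \<and> Q u \<le> e" if e: "e > 0" for e :: real
  proof -
    define \<eta> where "\<eta> = e / 4 ^ CARD('n)"
    have \<eta>: "\<eta> > 0" "4 ^ CARD('n) * \<eta> = e" using e by (auto simp: \<eta>_def)
    obtain \<delta> where \<delta>: "\<delta> > 0" "\<And>x y. x \<in> cbox 0 1 \<Longrightarrow> y \<in> cbox 0 1 \<Longrightarrow> dist x y < \<delta> \<Longrightarrow> dist (f x) (f y) < \<eta>"
      using unif \<eta>(1) unfolding uniformly_continuous_on_def by metis
    \<comment> \<open>The modulus of continuity fixes the level, the level fixes the constant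
      \<open>C\<close>, and only then is the crossing function taken with energy below
      \<open>e / (C + 1)\<close>. Passing to \<open>Suc m\<close> keeps the exponent
      positive.\<close>
    obtain m where m: "real CARD('n) / \<delta> < real l ^ m"
      using real_arch_pow[of "real l"] l_ge by auto
    have "real l ^ m \<le> real l ^ Suc m" using l_ge by (intro power_increasing) auto
    with m have "real CARD('n) / \<delta> < real l ^ Suc m" by linarith
    then have m': "real CARD('n) / real (l ^ Suc m) < \<delta>"
      using \<delta>(1) l_pos by (simp add: field_simps)
    obtain S' r' where "carpet_level K D E (l ^ Suc m) S' r'"
      using carpet_level_power[of "Suc m"] by auto
    then interpret L: carpet_level K D E "l ^ Suc m" S' r' .
    define C where "C = real (card S') / r' * (16 ^ CARD('n) * M\<^sup>2 * CARD('n))"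
    have C: "C \<ge> 0" unfolding C_def using L.r_pos by simp
    obtain u where u: "u \<in> crossing k" "Q u < e / (C + 1)"
      using small[of "e / (C + 1)"] e C by auto
    define U where "U j = (\<lambda>x. u (swap k j x))" for j
    have U: "U j \<in> crossing j" "Q (U j) \<le> e / (C + 1)" for j
      using crossing_swap[OF u(1)] Q_swap[OF crossingD(1)[OF u(1)]] u(2) by (auto simp: U_def)
    obtain w where w: "w \<in> D" "\<And>x. x \<in> K \<Longrightarrow> \<bar>w x - f x\<bar> \<le> 4 ^ CARD('n) * \<eta>" "Q w \<le> C * (e / (C + 1))"
      unfolding C_def[symmetric]
      by (rule L.interpolation_estimate[of U "e / (C + 1)" f M \<eta>, folded C_def])
        (use U f(3) \<delta>(2) m' in \<open>fastforce simp: dist_real_def\<close>)+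
    have "C * (e / (C + 1)) \<le> e" using C e by (simp add: field_simps)
    then show ?thesis using w f(2) \<eta>(2) by force
  qed
  then have "\<exists>u\<in>D. (\<forall>x\<in>K. \<bar>u x - v x\<bar> \<le> inverse (real (Suc n))) \<and> Q u \<le> inverse (real (Suc n))" for n
    by simp
  then obtain g where g: "\<And>n. g n \<in> D" "\<And>n x. x \<in> K \<Longrightarrow> \<bar>g n x - v x\<bar> \<le> inverse (real (Suc n))"
    "\<And>n. Q (g n) \<le> inverse (real (Suc n))" by metis
  have "uniform_limit K g v sequentially"
  proof (rule uniform_limitI)
    fix e :: real assume "e > 0"
    then have "\<forall>\<^sub>F n in sequentially. inverse (real (Suc n)) < e"
      using LIMSEQ_inverse_real_of_nat by (rule order_tendstoD(2)[rotated])
    then show "\<forall>\<^sub>F n in sequentially. \<forall>x\<in>K. dist (g n x) (v x) < e"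
    proof eventually_elim
      case (elim n)
      then show ?case using g(2)[of _ n] by (auto simp: dist_real_def intro: le_less_trans)
    qed
  qed
  moreover have "(\<lambda>n. Q (g n)) \<longlonglongrightarrow> 0"
    by (rule tendsto_sandwich[OF _ _ tendsto_const LIMSEQ_inverse_real_of_nat])
      (use g E_nonneg in auto)
  ultimately have "Q v = 0" using closed[of g v] g(1) v(1) by blast
  then show False using v(2) by simp
qed

lemma almost_minimal:
  assumes "\<delta> > 0"
  obtains u where "u \<in> crossing k" "\<And>v. v \<in> crossing k \<Longrightarrow> Q u \<le> Q v + \<delta>"
proof -
  have bdd: "bdd_below (Q ` crossing k)"
    using E_nonneg crossingD(1) by (intro bdd_belowI2[of _ 0]) blast
  have "Inf (Q ` crossing k) < Inf (Q ` crossing k) + \<delta>" using assms by simp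
  then obtain u where u: "u \<in> crossing k" "Q u < Inf (Q ` crossing k) + \<delta>"
    using cInf_lessD[of "Q ` crossing k"] crossing_nonempty by blast
  show thesis
  proof
    show "Q u \<le> Q v + \<delta>" if "v \<in> crossing k" for v
      using u(2) cInf_lower[OF imageI[OF that] bdd] by simp
  qed fact
qed

text \<open>Averaging over the reflections that fix the k-th coordinate does not raise the energy.
  The invariance makes the copies in \<open>rescaled_copy\<close> fit together and identifies
  coefficients in \<open>E_bump\<close>.\<close>

lemma symmetrize:
  assumes u: "u \<in> crossing k"
  obtains v where "v \<in> crossing k" "Q v \<le> Q u" "\<And>B x. k \<notin> B \<Longrightarrow> v (reflect B x) = v x"
proof -
  define X where "X = {B. k \<notin> B}"
  define N where "N = real (card X)"
  have "{} \<in> X" by (simp add: X_def)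
  then have N: "N > 0" unfolding N_def using card_gt_0_iff[of X] by (auto intro: finite_subset)
  define v where "v x = (\<Sum>B\<in>X. 1 / N * u (reflect B x))" for x
  have uD: "u \<in> D" using crossingD[OF u] by simp
  have D: "(\<lambda>x. 1 / N * u (reflect B x)) \<in> D" for B by (intro scale reflect_D uD)
  have v_const: "v x = c" if "\<And>B. B \<in> X \<Longrightarrow> u (reflect B x) = c" for x c
    using that \<open>{} \<in> X\<close> N by (auto simp: v_def N_def)
  show thesis
  proof
    show "v \<in> crossing k" unfolding crossing_def mem_Collect_eq
    proof (intro conjI ballI impI)
      show "v \<in> D" unfolding v_def by (intro sum_D D)
      fix x assume x: "x \<in> K"
      have b: "0 \<le> u (reflect B x)" "u (reflect B x) \<le> 1" for B
        using crossingD(2,3)[OF u reflect_K[OF x]] by auto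
      show "0 \<le> v x" unfolding v_def using N b by (intro sum_nonneg) simp
      have "v x \<le> (\<Sum>B\<in>X. 1 / N * 1)" unfolding v_def using N b by (intro sum_mono mult_left_mono) auto
      also have "\<dots> = 1" using N \<open>{} \<in> X\<close> by (auto simp: N_def)
      finally show "v x \<le> 1" .
      show "v x = 0" if "x $ k = 0"
        by (rule v_const, rule crossingD(4)[OF u reflect_K[OF x]]) (use that in \<open>simp add: X_def reflect_nth\<close>)
      show "v x = 1" if "x $ k = 1"
        by (rule v_const, rule crossingD(5)[OF u reflect_K[OF x]]) (use that in \<open>simp add: X_def reflect_nth\<close>)
    qed
    have "Q v \<le> N * (\<Sum>B\<in>X. Q (\<lambda>x. 1 / N * u (reflect B x)))"
      unfolding v_def
      using Q_sum_le[where I = X and f = "\<lambda>B x. 1 / N * u (reflect B x)", OF D]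
      by (simp only: N_def)
    also have "\<dots> = N * (\<Sum>B\<in>X. (1 / N)\<^sup>2 * Q u)"
      by (simp only: Q_scale[OF reflect_D[OF uD]] Q_reflect[OF uD])
    also have "\<dots> = Q u" using N by (simp add: N_def[symmetric] power2_eq_square)
    finally show "Q v \<le> Q u" .
    show "v (reflect C x) = v x" if "k \<notin> C" for C x
      unfolding v_def
      by (rule sum.reindex_bij_witness[of _ "\<lambda>B. sym_diff B C" "\<lambda>B. sym_diff B C"])
        (use that in \<open>auto simp: X_def sym_diff_sym_diff reflect_reflect\<close>)
  qed
qed

text \<open>\<open>u + t w\<close> keeps the boundary values but may leave \<open>[0,1]\<close>.
  Clamping repairs this without raising the energy, so every real \<open>t\<close> is admissible in
  the first variation.\<close>

lemma almost_minimal_orthogonal: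
  assumes u: "u \<in> crossing k" and min: "\<And>v. v \<in> crossing k \<Longrightarrow> Q u \<le> Q v + \<delta>"
    and w: "w \<in> D" "\<And>x. x \<in> K \<Longrightarrow> x $ k = 0 \<or> x $ k = 1 \<Longrightarrow> w x = 0"
  shows "(E u w)\<^sup>2 \<le> \<delta> * Q w"
proof (rule almost_orthogonal[OF crossingD(1)[OF u] w(1)])
  fix t
  let ?v = "\<lambda>x. u x + t * w x"
  have v: "?v \<in> D" by (intro add scale crossingD(1)[OF u] w)
  have "(\<lambda>x. min (max (?v x) 0) 1) \<in> crossing k"
    by (rule crossing_clamp[OF v]) (use crossingD(4,5)[OF u] w(2) in auto)
  from min[OF this] show "Q u - \<delta> \<le> Q ?v" using clamp_D(2)[OF v] by simp
qed

end

section \<open>The strict inequality\<close>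

definition replace :: "nat^'n \<Rightarrow> 'n \<Rightarrow> nat \<Rightarrow> nat^'n" where
  "replace a k c = (\<chi> j. if j = k then c else a $ j)"

lemma replace_nth: "replace a k c $ j = (if j = k then c else a $ j)"
  by (simp add: replace_def)

text \<open>Replace the coordinates of \<open>i\<close> by those of \<open>j\<close> one at a time;
  \<open>m B\<close> has done so for those in \<open>B\<close>. If no unit step along an axis
  changed membership in \<open>S\<close>, neither would the whole walk.\<close>

lemma exists_boundary_pair:
  fixes S :: "(nat^'n) set"
  assumes "i \<in> S" "\<And>k. i $ k < l" "j \<notin> S" "\<And>k. j $ k < l"
  obtains a k c where "Suc c < l" "replace a k c \<in> S \<longleftrightarrow> replace a k (Suc c) \<notin> S"
proof -
  define m where "m B = (\<chi> k. if k \<in> B then j $ k else i $ k)" for B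
  have "\<exists>a k c. Suc c < l \<and> (replace a k c \<in> S \<longleftrightarrow> replace a k (Suc c) \<notin> S)"
  proof (rule ccontr)
    assume "\<not> ?thesis"
    then have step: "replace a k c \<in> S \<longleftrightarrow> replace a k (Suc c) \<in> S" if "Suc c < l" for a k c
      using that by blast
    have zero: "replace a k c \<in> S \<longleftrightarrow> replace a k 0 \<in> S" if "c < l" for a k c
      using that by (induction c) (use step in auto)
    have "m B \<in> S" for B
      using finite[of B]
    proof (induction B rule: finite_induct)
      case empty
      then show ?case using assms(1) by (simp add: m_def)
    next
      case (insert k B)
      have "m (insert k B) = replace (m B) k (j $ k)"
        by (simp add: vec_eq_iff m_def replace_nth)
      moreover have "m B = replace (m B) k (i $ k)"
        using insert by (auto simp: vec_eq_iff m_def replace_nth)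
      ultimately show ?case
        using zero[OF assms(2)[of k], of "m B" k] zero[OF assms(4)[of k], of "m B" k] insert.IH by simp
    qed
    from this[of UNIV] show False using assms(3) by (simp add: m_def)
  qed
  then show ?thesis using that by blast
qed

text \<open>The test function has grid values \<open>weight\<close>: it is concentrated on the hyperplane with
  \<open>k\<close>-th coordinate \<open>Suc c\<close>, and along each other axis \<open>j\<close> it vanishes up to \<open>a $ j\<close> and then
  alternates in sign, so that the sum of its values at the two ends of an edge is nonzero only for
  the edge starting at \<open>a $ j\<close>.\<close>

definition axis_weight :: "nat^'n \<Rightarrow> 'n \<Rightarrow> nat \<Rightarrow> 'n \<Rightarrow> nat \<Rightarrow> real" where
  "axis_weight a k c j m =
    (if j = k then (if m = Suc c then 1 else 0) else if m > a $ j then (- 1) ^ (m - a $ j - 1) else 0)"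

definition weight :: "nat^'n \<Rightarrow> 'n \<Rightarrow> nat \<Rightarrow> nat^'n \<Rightarrow> real" where
  "weight a k c n = (\<Prod>j\<in>UNIV. axis_weight a k c j (n $ j))"

lemma axis_weight_edge:
  assumes "j \<noteq> k"
  shows "axis_weight a k c j (Suc m) + axis_weight a k c j m = (if m = a $ j then 1 else 0)"
proof -
  consider "m < a $ j" | "m = a $ j" | n where "m = Suc (a $ j + n)"
    by (metis less_imp_Suc_add linorder_neqE_nat)
  then show ?thesis
    by cases (use assms in \<open>auto simp: axis_weight_def\<close>)
qed

text \<open>The weight is a product over the axes, so the sum over corners is a product over edges,
  with \<open>f\<close> for the upper and \<open>g\<close> for the signed lower end. Along
  \<open>k\<close>, the hyperplane \<open>Suc c\<close> is the upper face of cells with index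
  \<open>c\<close> and the lower face of those with index \<open>Suc c\<close>, hence the two
  signs.\<close>

lemma sum_weight_cell:
  "(\<Sum>A\<in>UNIV. (if k \<in> A then 1 else - 1) * weight a k c (shift i A)) =
    (if i = replace a k c then 1 else 0) - (if i = replace a k (Suc c) then 1 else (0 :: real))"
proof -
  define f where "f j = axis_weight a k c j (Suc (i $ j))" for j
  define g where "g j = (if j = k then - 1 else 1) * axis_weight a k c j (i $ j)" for j
  have "(if k \<in> A then 1 else - 1) * weight a k c (shift i A) = prod f A * prod g (UNIV - A)" for A
  proof -
    have UNIV: "UNIV = A \<union> (UNIV - A)" by auto
    have "weight a k c (shift i A) =
        (\<Prod>j\<in>A. axis_weight a k c j (Suc (i $ j))) * (\<Prod>j\<in>UNIV - A. axis_weight a k c j (i $ j))"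
      unfolding weight_def by (subst UNIV, subst prod.union_disjoint)
        (auto simp: shift_nth intro!: arg_cong2[where f = "(*)"] prod.cong)
    moreover have "prod g (UNIV - A) = (\<Prod>j\<in>UNIV - A. if j = k then - 1 else 1) *
        (\<Prod>j\<in>UNIV - A. axis_weight a k c j (i $ j))"
      unfolding g_def by (rule prod.distrib)
    moreover have "(\<Prod>j\<in>UNIV - A. if j = k then - 1 else (1 :: real)) = (if k \<in> A then 1 else - 1)"
      by (simp add: prod.delta)
    ultimately show ?thesis by (simp add: f_def)
  qed
  then have "(\<Sum>A\<in>UNIV. (if k \<in> A then 1 else - 1) * weight a k c (shift i A)) =
      (\<Prod>j\<in>UNIV. f j + g j)"
    by (simp add: prod_add)
  also have "\<dots> = (f k + g k) * (\<Prod>j\<in>UNIV - {k}. f j + g j)"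
    by (simp add: prod.remove)
  also have "(\<Prod>j\<in>UNIV - {k}. f j + g j) = (\<Prod>j\<in>UNIV - {k}. if i $ j = a $ j then 1 else 0)"
    by (rule prod.cong) (auto simp: f_def g_def axis_weight_edge)
  also have "\<dots> = (if \<forall>j. j \<noteq> k \<longrightarrow> i $ j = a $ j then 1 else 0)"
    by (auto intro!: prod.neutral)
  finally show ?thesis
    by (auto simp: f_def g_def axis_weight_def vec_eq_iff replace_nth)
qed

section \<open>Comparison of an almost minimiser with its rescaled copy\<close>

context carpet_form
begin

text \<open>Reflections fixing the k-th coordinate preserve \<open>u\<close> and permute the bumps,
  so the value depends only on whether \<open>k \<in> A\<close>. The two values are opposite because
  the bumps sum to the constant 1, which pairs to 0 with \<open>u\<close>.\<close>

lemma E_bump: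
  assumes u: "u \<in> crossing k" and sym: "\<And>B x. k \<notin> B \<Longrightarrow> u (reflect B x) = u x"
    and U: "\<And>j. U j \<in> crossing j"
  shows "E u (bump U A) = (if k \<in> A then 1 else - 1) * E u (bump U {k})"
proof -
  have D: "bump U A \<in> D" for A
    by (rule bump_D(1)[OF U Max_ge[of "range (\<lambda>k. Q (U k))"]]) auto
  have uD: "u \<in> D" by (rule crossingD(1)[OF u])
  have eq: "E u (bump U A) = E u (bump U B)" if AB: "k \<in> A \<longleftrightarrow> k \<in> B" for A B
  proof -
    let ?C = "sym_diff A B"
    have "E u (bump U A) = E (\<lambda>x. u (reflect ?C x)) (\<lambda>x. bump U A (reflect ?C x))"
      by (rule E_reflect[OF uD D, symmetric])
    also have "(\<lambda>x. u (reflect ?C x)) = u" using AB by (auto simp: sym)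
    also have "(\<lambda>x. bump U A (reflect ?C x)) = bump U B"
    proof -
      have "sym_diff A ?C = B" by auto
      then show ?thesis by (simp only: bump_reflect)
    qed
    finally show ?thesis .
  qed
  have "(\<Sum>A\<in>UNIV. E u (bump U A)) = E u (\<lambda>x. \<Sum>A\<in>UNIV. bump U A x)"
    by (rule E_sum2[symmetric]) (use D uD in auto)
  also have "\<dots> = 0" by (simp add: sum_bump E_one_right[OF uD])
  finally have sum0: "(\<Sum>A\<in>UNIV. E u (bump U A)) = 0" .
  \<comment> \<open>Pairing \<open>A\<close> with \<open>sym_diff A {k}\<close> makes all summands
    equal.\<close>
  have "2 * (\<Sum>A\<in>UNIV. E u (bump U A)) =
      (\<Sum>A\<in>UNIV. E u (bump U A)) + (\<Sum>A\<in>UNIV. E u (bump U (sym_diff A {k})))"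
    using sum_sym_diff[of "\<lambda>A. E u (bump U A)" "{k}"] by simp
  also have "\<dots> = (\<Sum>A\<in>(UNIV :: 'n set set). E u (bump U {k}) + E u (bump U {}))"
    unfolding sum.distrib[symmetric]
  proof (rule sum.cong[OF refl])
    fix A :: "'n set"
    show "E u (bump U A) + E u (bump U (sym_diff A {k})) = E u (bump U {k}) + E u (bump U {})"
      using eq[of A "{k}"] eq[of A "{}"] eq[of "sym_diff A {k}" "{k}"] eq[of "sym_diff A {k}" "{}"]
      by (cases "k \<in> A") auto
  qed
  finally have "E u (bump U {}) = - E u (bump U {k})" using sum0 by simp
  then show ?thesis using eq[of A "{k}"] eq[of A "{}"] by auto
qed

text \<open>At a common point of two cells with equal k-th index, the local coordinates differ by a
  reflection that leaves the k-th one alone, so the symmetry of \<open>u\<close> gives agreement.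
  Between cells adjacent along \<open>k\<close>, the rise of \<open>u\<close> from 0 to 1 matches
  the unit step of the index.\<close>

lemma rescaled_copy:
  assumes u: "u \<in> crossing k" and sym: "\<And>B x. k \<notin> B \<Longrightarrow> u (reflect B x) = u x"
  obtains v where "v \<in> crossing k"
    "\<And>i x. i \<in> S \<Longrightarrow> x \<in> K \<Longrightarrow> v (cell_map l i x) = 1 / real l * u x + real (i $ k) / real l"
    "Q v = real (card S) / (r * (real l)\<^sup>2) * Q u"
proof -
  have uD: "u \<in> D" by (rule crossingD(1)[OF u])
  have cases: "i $ j = i' $ j \<and> y $ j = z $ j \<or> i $ j = Suc (i' $ j) \<and> y $ j = 0 \<and> z $ j = 1 \<or>
      i' $ j = Suc (i $ j) \<and> y $ j = 1 \<and> z $ j = 0"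
    if "y \<in> K" "z \<in> K" "cell_map l i y = cell_map l i' z" for i i' y z j
    using cell_overlap[OF l_pos that(3)] that(1,2) K_unit by blast
  obtain v where v: "v \<in> D" "\<And>i x. i \<in> S \<Longrightarrow> x \<in> K \<Longrightarrow>
      v (cell_map l i x) = 1 / real l * u x + real (i $ k) / real l"
  proof (rule pasting[of "\<lambda>i x. 1 / real l * u x + real (i $ k) / real l"])
    show "(\<lambda>x. 1 / real l * u x + real (i $ k) / real l) \<in> D" for i by (rule affine[OF uD])
    fix i j y z
    assume *: "i \<in> S" "j \<in> S" "y \<in> K" "z \<in> K" "cell_map l i y = cell_map l j z"
    have "u y + real (i $ k) = u z + real (j $ k)"
    proof (cases "i $ k = j $ k")
      case True
      define B where "B = {m. y $ m \<noteq> z $ m}"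
      have "z = reflect B y" unfolding vec_eq_iff
      proof
        show "z $ m = reflect B y $ m" for m
          using cases[OF *(3-5), of m] by (auto simp: B_def reflect_nth)
      qed
      moreover have "k \<notin> B" using cases[OF *(3-5), of k] True by (auto simp: B_def)
      ultimately show ?thesis using sym True by simp
    next
      case False
      then consider "i $ k = Suc (j $ k)" "y $ k = 0" "z $ k = 1" |
          "j $ k = Suc (i $ k)" "y $ k = 1" "z $ k = 0"
        using cases[OF *(3-5), of k] by blast
      then show ?thesis by cases (use crossingD(4,5)[OF u] *(3,4) in simp_all)
    qed
    then show "1 / real l * u y + real (i $ k) / real l = 1 / real l * u z + real (j $ k) / real l"
      by (simp add: add_divide_distrib[symmetric])
  qed (use that in blast)
  have vc: "v \<in> crossing k" unfolding crossing_def mem_Collect_eq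
  proof (intro conjI ballI impI v(1))
    fix x assume "x \<in> K"
    then obtain i y where iy: "i \<in> S" "y \<in> K" "x = cell_map l i y" by (rule cellE)
    have vx: "v x = (u y + real (i $ k)) / real l"
      using v(2)[OF iy(1,2)] iy(3) by (simp add: add_divide_distrib)
    have xk: "x $ k = (y $ k + real (i $ k)) / real l" using iy(3) by (simp add: cell_map_nth)
    have yk: "0 \<le> y $ k" "y $ k \<le> 1" using iy(2) K_unit by (auto simp: mem_unit_cube)
    have ik: "real (i $ k) + 1 \<le> real l" using index_less[OF iy(1), of k] by simp
    have uy: "0 \<le> u y" "u y \<le> 1" using crossingD(2,3)[OF u iy(2)] .
    show "0 \<le> v x" unfolding vx using uy by simp
    show "v x \<le> 1" unfolding vx using uy ik l_pos by (simp add: divide_le_eq_1)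
    show "v x = 0" if "x $ k = 0"
    proof -
      have "y $ k + real (i $ k) = 0" using that xk l_pos by simp
      then have "y $ k = 0" "real (i $ k) = 0" using yk by linarith+
      then show ?thesis using vx crossingD(4)[OF u iy(2)] by simp
    qed
    show "v x = 1" if "x $ k = 1"
    proof -
      have "y $ k + real (i $ k) = real l" using that xk l_pos by (simp add: field_simps)
      then have "y $ k = 1" "1 + real (i $ k) = real l" using yk ik by linarith+
      then show ?thesis using vx crossingD(5)[OF u iy(2)] l_pos by simp
    qed
  qed
  have "Q (\<lambda>x. v (cell_map l i x)) = (1 / real l)\<^sup>2 * Q u" if i: "i \<in> S" for i
  proof -
    have "Q (\<lambda>x. v (cell_map l i x)) = Q (\<lambda>x. 1 / real l * u x + real (i $ k) / real l)"
      by (rule E_cong) (simp_all only: v(2)[OF i] affine[OF uD])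
    then show ?thesis by (simp only: Q_affine[OF uD])
  qed
  then have "Q v = real (card S) / (r * (real l)\<^sup>2) * Q u"
    unfolding Q_self_similar[OF v(1)] by (simp add: field_simps)
  then show ?thesis using that vc v(2) by blast
qed

text \<open>The additive constants of the copies carry no energy, so every cell pairs
  \<open>u / l\<close> with a combination of bumps, and \<open>E_bump\<close> extracts a common
  factor.\<close>

lemma E_rescaled_copy:
  assumes u: "u \<in> crossing k" and sym: "\<And>B x. k \<notin> B \<Longrightarrow> u (reflect B x) = u x"
    and U: "\<And>j. U j \<in> crossing j"
    and v: "v \<in> D" "\<And>i x. i \<in> S \<Longrightarrow> x \<in> K \<Longrightarrow>
      v (cell_map l i x) = 1 / real l * u x + real (i $ k) / real l"
    and w: "w \<in> D" "\<And>i x. i \<in> S \<Longrightarrow> x \<in> K \<Longrightarrow>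
      w (cell_map l i x) = (\<Sum>A\<in>UNIV. q (shift i A) * bump U A x)"
  shows "r * real l * E v w =
    E u (bump U {k}) * (\<Sum>i\<in>S. \<Sum>A\<in>UNIV. (if k \<in> A then 1 else - 1) * q (shift i A))"
proof -
  have D: "bump U A \<in> D" for A
    by (rule bump_D(1)[OF U Max_ge[of "range (\<lambda>k. Q (U k))"]]) auto
  have uD: "u \<in> D" by (rule crossingD(1)[OF u])
  have "E (\<lambda>x. v (cell_map l i x)) (\<lambda>x. w (cell_map l i x)) =
      1 / real l * (E u (bump U {k}) * (\<Sum>A\<in>UNIV. (if k \<in> A then 1 else - 1) * q (shift i A)))"
    if i: "i \<in> S" for i
  proof -
    have wD: "(\<lambda>x. \<Sum>A\<in>UNIV. q (shift i A) * bump U A x) \<in> D"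
      by (intro sum_D scale D)
    have "E (\<lambda>x. v (cell_map l i x)) (\<lambda>x. w (cell_map l i x)) =
        E (\<lambda>x. 1 / real l * u x + real (i $ k) / real l) (\<lambda>x. \<Sum>A\<in>UNIV. q (shift i A) * bump U A x)"
      by (rule E_cong) (simp_all only: v(2)[OF i] w(2)[OF i] affine[OF uD] wD)
    also have "\<dots> = 1 / real l * E u (\<lambda>x. \<Sum>A\<in>UNIV. q (shift i A) * bump U A x)"
      by (rule E_affine[OF uD wD])
    also have "E u (\<lambda>x. \<Sum>A\<in>UNIV. q (shift i A) * bump U A x) =
        (\<Sum>A\<in>UNIV. E u (\<lambda>x. q (shift i A) * bump U A x))"
      by (rule E_sum2) (use scale D uD in auto)
    also have "\<dots> = (\<Sum>A\<in>UNIV. E u (bump U {k}) * ((if k \<in> A then 1 else - 1) * q (shift i A)))"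
    proof (rule sum.cong[OF refl])
      fix A
      show "E u (\<lambda>x. q (shift i A) * bump U A x) =
          E u (bump U {k}) * ((if k \<in> A then 1 else - 1) * q (shift i A))"
        unfolding E_scale2[OF D uD] using E_bump[OF u sym U, of A] by simp
    qed
    also have "\<dots> = E u (bump U {k}) * (\<Sum>A\<in>UNIV. (if k \<in> A then 1 else - 1) * q (shift i A))"
      by (rule sum_distrib_left[symmetric])
    finally show ?thesis .
  qed
  then have "(\<Sum>i\<in>S. E (\<lambda>x. v (cell_map l i x)) (\<lambda>x. w (cell_map l i x))) / r =
      (\<Sum>i\<in>S. 1 / real l * (E u (bump U {k}) *
      (\<Sum>A\<in>UNIV. (if k \<in> A then 1 else - 1) * q (shift i A)))) / r"
    by (intro arg_cong2[where f = "(/)"] sum.cong refl)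
  also have "\<dots> = 1 / real l * (E u (bump U {k}) *
      (\<Sum>i\<in>S. \<Sum>A\<in>UNIV. (if k \<in> A then 1 else - 1) * q (shift i A))) / r"
    by (simp only: sum_distrib_left)
  finally show ?thesis unfolding E_self_similar[OF v(1) w(1)] using r_pos l_pos by simp
qed

lemma card_gt:
  assumes "i \<in> S" "j \<notin> S" "\<And>k. j $ k < l"
  shows "real (card S) > r * (real l)\<^sup>2"
proof (rule ccontr)
  assume contra: "\<not> ?thesis"
  obtain a k c where c: "Suc c < l" and ac: "replace a k c \<in> S \<longleftrightarrow> replace a k (Suc c) \<notin> S"
    using exists_boundary_pair[OF assms(1) index_less[OF assms(1)] assms(2,3)] by blast
  obtain e where e: "e > 0" "\<And>u. u \<in> crossing k \<Longrightarrow> e \<le> Q u"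
    using crossing_energy_pos by blast
  obtain u0 where u0: "u0 \<in> crossing k" using crossing_nonempty by blast
  define U where "U j = (\<lambda>x. u0 (swap k j x))" for j
  have U: "U j \<in> crossing j" for j unfolding U_def by (rule crossing_swap[OF u0])
  have D: "bump U A \<in> D" for A
    by (rule bump_D(1)[OF U Max_ge[of "range (\<lambda>k. Q (U k))"]]) auto
  obtain w where w: "w \<in> D" "\<And>i x. i \<in> S \<Longrightarrow> x \<in> K \<Longrightarrow>
      w (cell_map l i x) = (\<Sum>A\<in>UNIV. weight a k c (shift i A) * bump U A x)"
    using interpolation[OF U, of "weight a k c"] by blast
  have weight_zero: "weight a k c n = 0" if "n $ k \<noteq> Suc c" for n
    unfolding weight_def using that by (intro prod_zero bexI[of _ k]) (auto simp: axis_weight_def)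
  \<comment> \<open>As \<open>0 < Suc c < l\<close>, the hyperplane carrying the weight is neither
    of the two faces; in a cell touching a face, the bumps of corners off that face vanish on
    it.\<close>
  have w0: "w x = 0" if x: "x \<in> K" "x $ k = 0 \<or> x $ k = 1" for x
  proof -
    obtain i y where iy: "i \<in> S" "y \<in> K" "x = cell_map l i y" using cellE[OF x(1)] .
    have xk: "x $ k = (y $ k + real (i $ k)) / real l" using iy(3) by (simp add: cell_map_nth)
    have yk: "0 \<le> y $ k" "y $ k \<le> 1" using iy(2) K_unit by (auto simp: mem_unit_cube)
    have ik: "real (i $ k) + 1 \<le> real l" using index_less[OF iy(1), of k] by simp
    have "weight a k c (shift i A) * bump U A y = 0" for A
      using x(2)
    proof
      assume "x $ k = 0"
      then have "y $ k + real (i $ k) = 0" using xk l_pos by simp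
      then have "y $ k = 0" "i $ k = 0" using yk by linarith+
      then show ?thesis
        using bump_zero[OF U iy(2), of k A] weight_zero[of "shift i A"]
        by (cases "k \<in> A") (auto simp: shift_nth)
    next
      assume "x $ k = 1"
      then have "y $ k + real (i $ k) = real l" using xk l_pos by (simp add: field_simps)
      then have "y $ k = 1" "i $ k + 1 = l" using yk ik by linarith+
      then show ?thesis
        using bump_zero[OF U iy(2), of k A] weight_zero[of "shift i A"] c
        by (cases "k \<in> A") (auto simp: shift_nth)
    qed
    then have "(\<Sum>A\<in>UNIV. weight a k c (shift i A) * bump U A y) = 0"
      by (intro sum.neutral ballI)
    then show ?thesis using w(2)[OF iy(1,2)] iy(3) by simp
  qed
  define W where "W x = (\<Sum>A | k \<in> A. bump U A x)" for x
  have WD: "W \<in> D" unfolding W_def by (intro sum_D D)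
  have W_0: "W x = 0" if "x \<in> K" "x $ k = 0" for x
    unfolding W_def using bump_zero[OF U that(1), of k] that(2) by (intro sum.neutral) auto
  have W_1: "W x = 1" if "x \<in> K" "x $ k = 1" for x
  proof -
    have "W x = (\<Sum>A\<in>UNIV. bump U A x)"
      unfolding W_def using bump_zero[OF U that(1), of k] that(2) by (intro sum.mono_neutral_left) auto
    then show ?thesis by (simp add: sum_bump)
  qed
  define n where "n = real (card {A. k \<in> A})"
  \<comment> \<open>Collected from the last estimate of \<open>main\<close>. The \<open>+ 1\<close>
    stands for \<delta> in \<open>Q u \<le> Q u0 + \<delta>\<close>.\<close>
  define C where "C = 2 * (2 * (Q u0 + 1) + 2 * Q W) + 2 * n\<^sup>2 * ((r * real l)\<^sup>2 * Q w)"
  have C: "C > 0"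
    unfolding C_def using E_nonneg[OF crossingD(1)[OF u0]] E_nonneg[OF WD] E_nonneg[OF w(1)]
    by (intro add_pos_nonneg mult_nonneg_nonneg) auto
  have main: "e\<^sup>2 \<le> C * \<delta>" if \<delta>: "0 < \<delta>" "\<delta> \<le> 1" for \<delta>
  proof -
    obtain u1 where u1: "u1 \<in> crossing k" "\<And>v. v \<in> crossing k \<Longrightarrow> Q u1 \<le> Q v + \<delta>"
      using almost_minimal[OF \<delta>(1)] by blast
    obtain u where u: "u \<in> crossing k" "Q u \<le> Q u1" and sym: "\<And>B x. k \<notin> B \<Longrightarrow> u (reflect B x) = u x"
      using symmetrize[OF u1(1)] by blast
    have uD: "u \<in> D" by (rule crossingD(1)[OF u(1)])
    have u_min: "Q u \<le> Q v + \<delta>" if "v \<in> crossing k" for v using u(2) u1(2)[OF that] by simp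
    obtain v where v: "v \<in> crossing k" and v_eq: "\<And>i x. i \<in> S \<Longrightarrow> x \<in> K \<Longrightarrow>
        v (cell_map l i x) = 1 / real l * u x + real (i $ k) / real l"
      and Qv: "Q v = real (card S) / (r * (real l)\<^sup>2) * Q u"
      by (rule rescaled_copy[OF u(1) sym]) (assumption | rule that)+
    \<comment> \<open>The assumption to be refuted enters here: rescaling does not raise the energy,
      so \<open>v\<close> is almost minimal with the same \<delta> as \<open>u\<close>.\<close>
    have "real (card S) / (r * (real l)\<^sup>2) \<le> 1" using contra r_pos l_pos by (simp add: divide_le_eq_1)
    then have "Q v \<le> Q u" unfolding Qv using E_nonneg[OF uD] by (intro mult_left_le_one_le) (use r_pos in auto)
    then have v_min: "Q v \<le> Q v' + \<delta>" if "v' \<in> crossing k" for v' using u_min[OF that] by simp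
    let ?\<alpha> = "E u (bump U {k})"
    define \<Lambda> where "\<Lambda> = (\<Sum>i\<in>S. \<Sum>A\<in>UNIV. (if k \<in> A then 1 else - 1) * weight a k c (shift i A))"
    have "\<Lambda> = (if replace a k c \<in> S then 1 else 0) - (if replace a k (Suc c) \<in> S then 1 else 0)"
      by (simp add: \<Lambda>_def sum_weight_cell sum_subtractf S_finite)
    \<comment> \<open>Exactly one of the two cells belongs to \<open>S\<close>; which one only
      affects the sign.\<close>
    then have "\<Lambda>\<^sup>2 = 1" using ac by auto
    moreover have "r * real l * E v w = ?\<alpha> * \<Lambda>"
      unfolding \<Lambda>_def
      by (rule E_rescaled_copy[where q = "weight a k c" and U = U and u = u and v = v and w = w and k = k,
            OF u(1) sym U crossingD(1)[OF v] v_eq w])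
    then have "(r * real l * E v w)\<^sup>2 = (?\<alpha> * \<Lambda>)\<^sup>2" by simp
    ultimately have "?\<alpha>\<^sup>2 = (r * real l)\<^sup>2 * (E v w)\<^sup>2"
      by (simp add: power_mult_distrib)
    also have "\<dots> \<le> (r * real l)\<^sup>2 * (\<delta> * Q w)"
      by (intro mult_left_mono almost_minimal_orthogonal[OF v v_min w(1) w0]) auto
    finally have \<alpha>: "?\<alpha>\<^sup>2 \<le> (r * real l)\<^sup>2 * (\<delta> * Q w)" .
    let ?d = "\<lambda>x. u x - W x"
    have "(E u ?d)\<^sup>2 \<le> \<delta> * Q ?d"
      by (rule almost_minimal_orthogonal[OF u(1) u_min diff[OF uD WD]])
        (use crossingD(4,5)[OF u(1)] W_0 W_1 in auto)
    also have "\<dots> \<le> \<delta> * (2 * (Q u0 + 1) + 2 * Q W)"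
      using Q_diff_le[OF uD WD] u_min[OF u0] \<delta> by (intro mult_left_mono) auto
    finally have d: "(E u ?d)\<^sup>2 \<le> \<delta> * (2 * (Q u0 + 1) + 2 * Q W)" .
    have "E u W = (\<Sum>A | k \<in> A. E u (bump U A))"
      unfolding W_def by (rule E_sum2) (use D uD in auto)
    also have "\<dots> = (\<Sum>A | k \<in> A. ?\<alpha>)"
    proof (rule sum.cong[OF refl])
      fix A assume "A \<in> {A. k \<in> A}"
      then show "E u (bump U A) = ?\<alpha>"
        using E_bump[where U = U and u = u and k = k and A = A, OF u(1) sym U] by simp
    qed
    also have "\<dots> = n * ?\<alpha>" by (simp add: n_def)
    finally have "Q u = E u ?d + n * ?\<alpha>" using E_diff2[OF uD WD uD] by simp
    then have "e\<^sup>2 \<le> (E u ?d + n * ?\<alpha>)\<^sup>2"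
      using e(2)[OF u(1)] e(1) by (intro power_mono) auto
    also have "\<dots> \<le> 2 * (E u ?d)\<^sup>2 + 2 * n\<^sup>2 * ?\<alpha>\<^sup>2"
      using zero_le_power2[of "E u ?d - n * ?\<alpha>"] by (simp add: power2_eq_square algebra_simps)
    also have "\<dots> \<le> 2 * (\<delta> * (2 * (Q u0 + 1) + 2 * Q W)) + 2 * n\<^sup>2 * ((r * real l)\<^sup>2 * (\<delta> * Q w))"
      by (intro add_mono mult_left_mono d \<alpha>) auto
    also have "\<dots> = C * \<delta>" by (simp add: C_def algebra_simps)
    finally show ?thesis .
  qed
  \<comment> \<open>Chosen so that \<open>C * \<delta>\<close> is at most half of
    \<open>e\<^sup>2\<close>.\<close>
  define \<delta> where "\<delta> = min 1 (e\<^sup>2 / (2 * C))"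
  have "0 < \<delta>" "\<delta> \<le> 1" using e(1) C by (auto simp: \<delta>_def)
  then have "e\<^sup>2 \<le> C * \<delta>" by (rule main)
  also have "\<dots> \<le> C * (e\<^sup>2 / (2 * C))" using C by (intro mult_left_mono) (auto simp: \<delta>_def)
  also have "\<dots> = e\<^sup>2 / 2" using C by simp
  finally show False using e(1) by simp
qed

end

section \<open>The canonical Dirichlet form\<close>

lemma L2_cong:
  assumes "u \<in> L2 M" "\<And>x. x \<in> space M \<Longrightarrow> v x = u x" shows "v \<in> L2 M"
proof -
  have "v \<in> borel_measurable M \<longleftrightarrow> u \<in> borel_measurable M"
    by (rule measurable_cong) (rule assms(2))
  moreover have "integrable M (\<lambda>x. (v x)\<^sup>2) \<longleftrightarrow> integrable M (\<lambda>x. (u x)\<^sup>2)"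
    by (rule Bochner_Integration.integrable_cong) (simp_all add: assms(2))
  ultimately show ?thesis using assms(1) by (simp add: L2_def)
qed

lemma E1_dist_less_iff:
  "0 < e \<Longrightarrow> E1_dist M E u v < e \<longleftrightarrow>
    E (\<lambda>x. u x - v x) (\<lambda>x. u x - v x) + (\<integral>x. (u x - v x)\<^sup>2 \<partial>M) < e\<^sup>2"
  using real_sqrt_less_iff[of _ "e\<^sup>2"] by (simp add: E1_dist_def L2_inner_def Let_def power2_eq_square[symmetric])

lemma symmetric_form_quadratic_form:
  assumes "symmetric_form M E F" "(\<lambda>x. 1) \<in> F" "E (\<lambda>x. 1) (\<lambda>x. 1) = 0"
  shows "quadratic_form (space M) F E"
proof
  have F: "F \<subseteq> L2 M" "\<And>u v. u \<in> F \<Longrightarrow> v \<in> L2 M \<Longrightarrow> (AE x in M. u x = v x) \<Longrightarrow> v \<in> F"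
    "\<And>u u' v. u \<in> F \<Longrightarrow> u' \<in> F \<Longrightarrow> v \<in> F \<Longrightarrow> (AE x in M. u x = u' x) \<Longrightarrow> E u v = E u' v"
    using assms(1) unfolding symmetric_form_def by blast+
  show "v \<in> F" if "u \<in> F" "\<And>x. x \<in> space M \<Longrightarrow> v x = u x" for u v
    using F(2)[OF that(1) L2_cong[of u M v]] F(1) that by (auto intro: AE_I2)
  show "E u v = E u' v" if "u \<in> F" "u' \<in> F" "v \<in> F" "\<And>x. x \<in> space M \<Longrightarrow> u x = u' x" for u u' v
    using F(3)[OF that(1-3)] that(4) by (auto intro: AE_I2)
qed (use assms in \<open>unfold symmetric_form_def, blast+\<close>)

locale bounded_dirichlet_form = finite_measure M + quadratic_form "space M" F E
  for M :: "'a measure" and F E +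
  assumes measure_space: "measure M (space M) = 1"
    and dirichlet: "dirichlet_form M E F"
begin

lemma F_L2: "u \<in> F \<Longrightarrow> u \<in> L2 M"
  using dirichlet by (auto simp: dirichlet_form_def symmetric_form_def)

lemma E_cong_AE: "u \<in> F \<Longrightarrow> v \<in> F \<Longrightarrow> (AE x in M. u x = v x) \<Longrightarrow> E u u = E v v"
proof -
  assume *: "u \<in> F" "v \<in> F" "AE x in M. u x = v x"
  have sf: "symmetric_form M E F" using dirichlet by (simp add: dirichlet_form_def)
  have "E u u = E v u" using sf * unfolding symmetric_form_def by blast
  also have "\<dots> = E u v" by (rule E_sym) fact+
  also have "\<dots> = E v v" using sf * unfolding symmetric_form_def by blast
  finally show ?thesis .
qed

text \<open>The Markov property concerns truncation to \<open>[0,1]\<close>. For \<open>u\<close>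
  bounded by \<open>C\<close>, the positive part is \<open>C\<close> times the truncation of
  \<open>u / C\<close>, so scaling suffices; continuous functions on \<open>K\<close> are bounded.
  Taking \<open>C\<close> at least 1 permits the division.\<close>

lemma pos_part_bounded:
  assumes u: "u \<in> F" and B: "\<And>x. x \<in> space M \<Longrightarrow> \<bar>u x\<bar> \<le> B"
  shows "(\<lambda>x. max (u x) 0) \<in> F" "E (\<lambda>x. max (u x) 0) (\<lambda>x. max (u x) 0) \<le> E u u"
proof -
  define C where "C = max B 1"
  have C: "C > 0" "\<And>x. x \<in> space M \<Longrightarrow> u x \<le> C" using B unfolding C_def by fastforce+
  let ?v = "\<lambda>x. 1 / C * u x" and ?p = "\<lambda>x. min (max (1 / C * u x) 0) 1"
  have v: "?v \<in> F" by (rule scale[OF u])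
  have "markovian E F" using dirichlet by (simp add: dirichlet_form_def)
  from bspec[OF this[unfolded markovian_def Let_def] v]
  have p: "?p \<in> F" "E ?p ?p \<le> E ?v ?v" by simp_all
  have eq: "max (u x) 0 = C * ?p x" if "x \<in> space M" for x
    using C(2)[OF that] C(1) by (auto simp: max_def min_def field_simps)
  show "(\<lambda>x. max (u x) 0) \<in> F" by (rule D_cong[OF scale[OF p(1)] eq])
  have "E (\<lambda>x. max (u x) 0) (\<lambda>x. max (u x) 0) = E (\<lambda>x. C * ?p x) (\<lambda>x. C * ?p x)"
    by (rule E_cong[OF scale[OF p(1)] scale[OF p(1)]]) (use eq in auto)
  also have "\<dots> = C\<^sup>2 * E ?p ?p" by (rule Q_scale[OF p(1)])
  also have "\<dots> \<le> C\<^sup>2 * E ?v ?v" by (intro mult_left_mono p) auto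
  also have "\<dots> = C\<^sup>2 * ((1 / C)\<^sup>2 * E u u)" by (simp only: Q_scale[OF u])
  also have "\<dots> = E u u" using C(1) by (simp add: power_divide)
  finally show "E (\<lambda>x. max (u x) 0) (\<lambda>x. max (u x) 0) \<le> E u u" .
qed

lemma integral_square_le:
  assumes "w \<in> L2 M" "\<And>x. x \<in> space M \<Longrightarrow> \<bar>w x\<bar> \<le> s"
  shows "(\<integral>x. (w x)\<^sup>2 \<partial>M) \<le> s\<^sup>2"
proof -
  have "(\<integral>x. (w x)\<^sup>2 \<partial>M) \<le> (\<integral>x. s\<^sup>2 \<partial>M)"
    using assms by (intro integral_mono) (fastforce simp: L2_def simp flip: abs_le_square_iff)+
  then show ?thesis by (simp add: measure_space)
qed

lemma integral_square_diff_le: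
  assumes "u \<in> F" "v \<in> F" "w \<in> F"
  shows "(\<integral>x. (u x - v x)\<^sup>2 \<partial>M) \<le> 2 * (\<integral>x. (w x - u x)\<^sup>2 \<partial>M) + 2 * (\<integral>x. (w x - v x)\<^sup>2 \<partial>M)"
proof -
  have int: "integrable M (\<lambda>x. (f x - g x)\<^sup>2)" if "f \<in> F" "g \<in> F" for f g
    using F_L2[OF diff[OF that]] by (simp add: L2_def)
  have "(\<integral>x. (u x - v x)\<^sup>2 \<partial>M) \<le> (\<integral>x. 2 * (w x - u x)\<^sup>2 + 2 * (w x - v x)\<^sup>2 \<partial>M)"
  proof (rule integral_mono)
    show "(u x - v x)\<^sup>2 \<le> 2 * (w x - u x)\<^sup>2 + 2 * (w x - v x)\<^sup>2" for x
      using zero_le_power2[of "(w x - u x) + (w x - v x)"] by (simp add: power2_eq_square algebra_simps)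
  qed (use int assms in auto)
  also have "\<dots> = 2 * (\<integral>x. (w x - u x)\<^sup>2 \<partial>M) + 2 * (\<integral>x. (w x - v x)\<^sup>2 \<partial>M)"
    using int assms by simp
  finally show ?thesis .
qed

text \<open>For a probability measure the uniform norm dominates the L2 norm, so \<open>g\<close> is
  Cauchy for \<open>E1_dist\<close>. Closedness gives a limit of zero energy, and it agrees with
  \<open>u\<close> almost everywhere.\<close>

lemma energy_zero_of_uniform_limit:
  assumes g: "\<And>n. g n \<in> F" and u: "u \<in> F" and lim: "uniform_limit (space M) g u sequentially"
    and energy: "(\<lambda>n. E (g n) (g n)) \<longlonglongrightarrow> 0"
  shows "E u u = 0"
proof -
  have ev: "\<exists>N. \<forall>n\<ge>N. E (g n) (g n) < e \<and> (\<forall>x\<in>space M. \<bar>g n x - u x\<bar> < e)" if e: "e > 0" for e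
  proof -
    have "\<forall>\<^sub>F n in sequentially. E (g n) (g n) < e" using energy e by (rule order_tendstoD)
    moreover have "\<forall>\<^sub>F n in sequentially. \<forall>x\<in>space M. dist (g n x) (u x) < e"
      by (rule uniform_limitD[OF lim e])
    ultimately have "\<forall>\<^sub>F n in sequentially. E (g n) (g n) < e \<and> (\<forall>x\<in>space M. \<bar>g n x - u x\<bar> < e)"
      by eventually_elim (simp add: dist_real_def)
    then show ?thesis by (simp add: eventually_sequentially)
  qed
  have "\<forall>e>0. \<exists>N. \<forall>m\<ge>N. \<forall>n\<ge>N. E1_dist M E (g m) (g n) < e"
  proof (intro allI impI)
    fix e :: real assume e: "e > 0"
    \<comment> \<open>The energy of a difference is below \<open>4 * d\<close> and its uniform norm
      below \<open>2 * d\<close>; each then contributes at most half of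
      \<open>e\<^sup>2\<close>.\<close>
    define d where "d = min (e\<^sup>2 / 8) (e / 4)"
    have d: "d > 0" "d \<le> e\<^sup>2 / 8" "d \<le> e / 4" using e by (auto simp: d_def)
    obtain N where N: "\<And>n. n \<ge> N \<Longrightarrow> E (g n) (g n) < d"
      "\<And>n x. n \<ge> N \<Longrightarrow> x \<in> space M \<Longrightarrow> \<bar>g n x - u x\<bar> < d"
      using ev[OF d(1)] by blast
    have "E1_dist M E (g m) (g n) < e" if mn: "m \<ge> N" "n \<ge> N" for m n
    proof -
      have "E (\<lambda>x. g m x - g n x) (\<lambda>x. g m x - g n x) < e\<^sup>2 / 2"
        using Q_diff_le[OF g g, of m n] N(1)[OF mn(1)] N(1)[OF mn(2)] d(2) by linarith
      moreover have "(\<integral>x. (g m x - g n x)\<^sup>2 \<partial>M) \<le> (e / 2)\<^sup>2"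
      proof (rule integral_square_le[OF F_L2[OF diff[OF g g]]])
        show "\<bar>g m x - g n x\<bar> \<le> e / 2" if "x \<in> space M" for x
          using N(2)[OF mn(1) that] N(2)[OF mn(2) that] d(3) by linarith
      qed
      moreover have "(e / 2)\<^sup>2 \<le> e\<^sup>2 / 2" by (simp add: power2_eq_square)
      ultimately show ?thesis unfolding E1_dist_less_iff[OF e] by linarith
    qed
    then show "\<exists>N. \<forall>m\<ge>N. \<forall>n\<ge>N. E1_dist M E (g m) (g n) < e" by blast
  qed
  then obtain v where v: "v \<in> F" "(\<lambda>n. E1_dist M E (g n) v) \<longlonglongrightarrow> 0"
    using dirichlet g unfolding dirichlet_form_def closed_form_def by blast
  have bound: "E v v \<le> e \<and> (\<integral>x. (u x - v x)\<^sup>2 \<partial>M) \<le> e" if e: "e > 0" for e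
  proof -
    \<comment> \<open>Both quantities end up at most \<open>4 * d\<close>; the bound
      \<open>d \<le> 1\<close> serves to replace \<open>d\<^sup>2\<close> by
      \<open>d\<close>.\<close>
    define d where "d = min (e / 4) 1"
    have d: "d > 0" "d \<le> e / 4" "d \<le> 1" using e by (auto simp: d_def)
    have "\<forall>\<^sub>F n in sequentially. E1_dist M E (g n) v < sqrt d"
      using v(2) by (rule order_tendstoD) (use d in simp)
    then obtain N where N: "\<And>n. n \<ge> N \<Longrightarrow> E1_dist M E (g n) v < sqrt d"
      by (auto simp: eventually_sequentially)
    obtain N' where N': "\<And>n. n \<ge> N' \<Longrightarrow> E (g n) (g n) < d"
      "\<And>n x. n \<ge> N' \<Longrightarrow> x \<in> space M \<Longrightarrow> \<bar>g n x - u x\<bar> < d"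
      using ev[OF d(1)] by blast
    define n where "n = max N N'"
    have n: "n \<ge> N" "n \<ge> N'" by (auto simp: n_def)
    have 1: "E (\<lambda>x. g n x - v x) (\<lambda>x. g n x - v x) + (\<integral>x. (g n x - v x)\<^sup>2 \<partial>M) < d"
      using N[OF n(1)] d(1) by (simp add: E1_dist_less_iff)
    have 2: "E (\<lambda>x. g n x - v x) (\<lambda>x. g n x - v x) \<ge> 0" by (rule E_nonneg[OF diff[OF g v(1)]])
    have 3: "(\<integral>x. (g n x - v x)\<^sup>2 \<partial>M) \<ge> 0" by simp
    have "E v v \<le> 2 * E (g n) (g n) + 2 * E (\<lambda>x. g n x - v x) (\<lambda>x. g n x - v x)"
      using Q_diff_le[OF g diff[OF g v(1)], of n n] by simp
    then have "E v v \<le> e" using N'(1)[OF n(2)] 1 3 d(2) by linarith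
    moreover have "(\<integral>x. (g n x - u x)\<^sup>2 \<partial>M) \<le> d\<^sup>2"
      using N'(2)[OF n(2)] by (intro integral_square_le[OF F_L2[OF diff[OF g u]]] less_imp_le)
    moreover have "d\<^sup>2 \<le> d" using d by (simp add: power2_eq_square mult_left_le)
    ultimately show ?thesis
      using integral_square_diff_le[OF u v(1) g, of n] 1 2 d(2) by linarith
  qed
  have "E v v \<le> 0" "(\<integral>x. (u x - v x)\<^sup>2 \<partial>M) \<le> 0"
    using bound by (meson field_le_epsilon add_increasing order_refl)+
  then have "(\<integral>x. (u x - v x)\<^sup>2 \<partial>M) = 0" by (simp add: antisym)
  moreover have "integrable M (\<lambda>x. (u x - v x)\<^sup>2)"
    using F_L2[OF diff[OF u v(1)]] by (simp add: L2_def)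
  ultimately have "AE x in M. (u x - v x)\<^sup>2 = 0"
    by (subst (asm) integral_nonneg_eq_0_iff_AE) auto
  then have "AE x in M. u x = v x" by simp
  then have "E u u = E v v" by (rule E_cong_AE[OF u v(1)])
  then show ?thesis using \<open>E v v \<le> 0\<close> E_nonneg[OF u] by simp
qed

end

text \<open>Passage from almost-everywhere classes to continuous functions with pointwise values on
  \<open>K\<close>, where faces and pasting make sense.\<close>

lemma carpet_formI:
  fixes S :: "(nat^'n) set" and K :: "(real^'n) set"
  assumes gsc: "generalized_sierpinski_carpet l S"
    and K: "self_similar_set l S K"
    and \<mu>: "self_similar_measure l S K \<mu>"
    and form: "canonical_dirichlet_form l S K \<mu> E F"
    and r: "scaling_factor l S K E F r"
  shows "carpet_form K (F \<inter> cont_funs K) E l S r"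
proof -
  have data: "l \<ge> 3" "S \<subset> {i. \<forall>k. i $ k \<in> {0..l - 1}}" and gsc1: "GSC1 l S"
    using gsc by (auto simp: generalized_sierpinski_carpet_def carpet_data_def)
  interpret self_similar l S K
  proof
    show "i $ k < l" if "i \<in> S" for i k
    proof -
      have "i $ k \<in> {0..l - 1}" using data(2) that by blast
      then show ?thesis using data(1) by simp
    qed
  qed (use data K in \<open>auto simp: self_similar_set_def\<close>)
  have space: "space \<mu> = K" using \<mu> by (simp add: self_similar_measure_def)
  have sets: "sets \<mu> = sets (restrict_space borel K)" using \<mu> by (simp add: self_similar_measure_def)
  have dir: "dirichlet_form \<mu> E F" and reg: "regular_form \<mu> E F"
    and nontriv: "\<exists>u\<in>F. E u u > 0"
    and one: "(\<lambda>x. 1) \<in> F" "E (\<lambda>x. 1) (\<lambda>x. 1) = 0"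
    and sym: "GSCDF1 K E F" and pasteF: "GSCDF2 l S K F"
    using form by (auto simp: canonical_dirichlet_form_def)
  have "quadratic_form (space \<mu>) F E"
    using dir one by (intro symmetric_form_quadratic_form) (auto simp: dirichlet_form_def)
  moreover have "emeasure \<mu> (space \<mu>) = 1"
    using \<mu> space by (simp add: self_similar_measure_def)
  then have "finite_measure \<mu>" "measure \<mu> (space \<mu>) = 1"
    by (auto intro: finite_measureI simp: measure_def)
  ultimately interpret F: bounded_dirichlet_form \<mu> F E
    using dir by (intro bounded_dirichlet_form.intro bounded_dirichlet_form_axioms.intro)
  let ?D = "F \<inter> cont_funs K"
  have compose: "continuous_on K (\<lambda>x. u (g x))"
    if "continuous_on K u" "continuous_on K g" "\<And>x. x \<in> K \<Longrightarrow> g x \<in> K" for u g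
    by (rule continuous_on_compose2[OF that(1,2)]) (use that(3) in auto)
  have isometry: "(\<lambda>x. u (g x)) \<in> ?D \<and> E (\<lambda>x. u (g x)) (\<lambda>x. u (g x)) = E u u"
    if u: "u \<in> ?D" and g: "g \<in> cube_isometries" "\<And>x. x \<in> K \<Longrightarrow> g x \<in> K" for u g
  proof -
    have "continuous_on K g"
      using g(1) unfolding cube_isometries_def continuous_on_iff by auto
    moreover have "u \<circ> g \<in> F \<and> E (u \<circ> g) (u \<circ> g) = E u u"
      using sym u g(1) unfolding GSCDF1_def by blast
    ultimately show ?thesis using compose[of u g] u g(2) by (simp add: cont_funs_def comp_def)
  qed
  have cell: "(\<lambda>x. u (cell_map l i x)) \<in> ?D" if "u \<in> ?D" "i \<in> S" for u i
  proof -
    have "u \<circ> cell_map l i \<in> F" using pasteF that unfolding GSCDF2_def by blast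
    moreover have "continuous_on K (\<lambda>x. u (cell_map l i x))"
      using compose[of u "cell_map l i"] continuous_cell_map[of K l i] that cell_in
      by (simp add: cont_funs_def)
    ultimately show ?thesis by (simp add: cont_funs_def comp_def)
  qed
  have pos: "(\<lambda>x. max (u x) 0) \<in> ?D \<and> E (\<lambda>x. max (u x) 0) (\<lambda>x. max (u x) 0) \<le> E u u"
    if u: "u \<in> ?D" for u
  proof -
    have "bounded (u ` K)"
      using u K_compact by (auto simp: cont_funs_def intro!: compact_imp_bounded compact_continuous_image)
    then obtain B where B: "\<And>x. x \<in> space \<mu> \<Longrightarrow> \<bar>u x\<bar> \<le> B"
      unfolding bounded_iff space by auto
    have "continuous_on K (\<lambda>x. max (u x) 0)" using u by (auto simp: cont_funs_def intro!: continuous_intros)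
    then show ?thesis using F.pos_part_bounded[of u B] B u by (simp add: cont_funs_def)
  qed
  show ?thesis
  proof
    fix u v w u' :: "real^'n \<Rightarrow> real" and c :: real and B and a b :: 'n and e :: real and i
      and g :: "nat \<Rightarrow> real^'n \<Rightarrow> real"
    show "v \<in> ?D" if "u \<in> ?D" "\<And>x. x \<in> K \<Longrightarrow> v x = u x"
      using that F.D_cong[of u v] continuous_on_cong[OF refl, of K v u] by (simp add: cont_funs_def space)
    show "E u v = E u' v" if "u \<in> ?D" "u' \<in> ?D" "v \<in> ?D" "\<And>x. x \<in> K \<Longrightarrow> u x = u' x"
      using that by (intro F.E_cong1) (auto simp: cont_funs_def space)
    show "(\<lambda>x. 1) \<in> ?D" using one by (simp add: cont_funs_def)
    show "E (\<lambda>x. 1) (\<lambda>x. 1) = 0" by fact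
    show "(\<lambda>x. u x + v x) \<in> ?D" if "u \<in> ?D" "v \<in> ?D"
      using that F.add[of u v] continuous_on_add[of K u v] by (simp add: cont_funs_def)
    show "(\<lambda>x. c * u x) \<in> ?D" if "u \<in> ?D"
      using that F.scale[of u c] continuous_on_mult_left[of K u c] by (simp add: cont_funs_def)
    show "E u v = E v u" if "u \<in> ?D" "v \<in> ?D" using that by (intro F.E_sym) auto
    show "E (\<lambda>x. u x + v x) w = E u w + E v w" if "u \<in> ?D" "v \<in> ?D" "w \<in> ?D"
      using that by (intro F.E_add) auto
    show "E (\<lambda>x. c * u x) w = c * E u w" if "u \<in> ?D" "w \<in> ?D"
      using that by (intro F.E_scale) auto
    show "0 \<le> E u u" if "u \<in> ?D" using that by (intro F.E_nonneg) auto
    show "continuous_on K u" if "u \<in> ?D" using that by (simp add: cont_funs_def)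
    show "(\<lambda>x. max (u x) 0) \<in> ?D" "E (\<lambda>x. max (u x) 0) (\<lambda>x. max (u x) 0) \<le> E u u"
      if "u \<in> ?D" using pos[OF that] by auto
    show "K \<subseteq> cbox 0 1" by (rule K_unit)
    show "reflect B x \<in> K" "swap a b x \<in> K" if "x \<in> K" for x
      using that gsc1 reflect_in swap_in by auto
    show "(\<lambda>x. u (reflect B x)) \<in> ?D" "E (\<lambda>x. u (reflect B x)) (\<lambda>x. u (reflect B x)) = E u u"
      if "u \<in> ?D" using isometry[OF that reflect_isometry] gsc1 reflect_in by auto
    show "(\<lambda>x. u (swap a b x)) \<in> ?D" "E (\<lambda>x. u (swap a b x)) (\<lambda>x. u (swap a b x)) = E u u"
      if "u \<in> ?D" using isometry[OF that swap_isometry] gsc1 swap_in by auto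
    show "r > 0" using r by (simp add: scaling_factor_def)
    show "u \<in> ?D" if "continuous_on K u" "\<And>i. i \<in> S \<Longrightarrow> (\<lambda>x. u (cell_map l i x)) \<in> ?D"
      using pasteF that unfolding GSCDF2_def by (auto simp: cont_funs_def comp_def)
    show "(\<lambda>x. u (cell_map l i x)) \<in> ?D" if "u \<in> ?D" "i \<in> S" by (rule cell[OF that])
    show "E u u = (\<Sum>i\<in>S. E (\<lambda>x. u (cell_map l i x)) (\<lambda>x. u (cell_map l i x))) / r" if "u \<in> ?D"
      using r that by (simp add: scaling_factor_def comp_def sum_divide_distrib)
    show "\<exists>v\<in>?D. \<forall>x\<in>K. \<bar>u x - v x\<bar> < e" if "continuous_on K u" "e > 0"
      using reg that unfolding regular_form_def space by (auto simp: cont_funs_def)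
    show "E u u = 0" if "\<And>n. g n \<in> ?D" "u \<in> ?D" "uniform_limit K g u sequentially"
        "(\<lambda>n. E (g n) (g n)) \<longlonglongrightarrow> 0"
      using that by (intro F.energy_zero_of_uniform_limit[of g u]) (auto simp: space)
    show "\<exists>u\<in>?D. E u u > 0"
    proof (rule ccontr)
      assume *: "\<not> ?thesis"
      obtain u where u: "u \<in> F" "E u u > 0" using nontriv by blast
      \<comment> \<open>At this distance, a continuous \<open>v\<close> of zero energy would give
        \<open>E u u < E u u\<close>; so regularity carries nontriviality over to continuous
        functions.\<close>
      define e where "e = sqrt (E u u / 2)"
      have e: "e > 0" "e\<^sup>2 = E u u / 2" using u(2) by (auto simp: e_def)
      obtain v where v: "v \<in> ?D" "E1_dist \<mu> E u v < e"
        using reg u(1) e(1) unfolding regular_form_def space by blast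
      have vF: "v \<in> F" using v(1) by simp
      have "E v v = 0" using * v(1) F.E_nonneg[OF vF] by force
      moreover have "E (\<lambda>x. u x - v x) (\<lambda>x. u x - v x) < E u u / 2"
      proof -
        have "(\<integral>x. (u x - v x)\<^sup>2 \<partial>\<mu>) \<ge> 0" by simp
        then show ?thesis using v(2) unfolding E1_dist_less_iff[OF e(1)] e(2) by linarith
      qed
      moreover have "E u u \<le> 2 * E (\<lambda>x. u x - v x) (\<lambda>x. u x - v x) + 2 * E v v"
        using F.Q_add_le[OF F.diff[OF u(1) vF] vF] by simp
      ultimately show False by linarith
    qed
  qed
qed

theorem theorem2p7:
  fixes l :: nat and S :: "(nat^'n) set"
    and K :: "(real^'n) set" and \<mu> :: "(real^'n) measure"
    and E :: "(real^'n \<Rightarrow> real) \<Rightarrow> (real^'n \<Rightarrow> real) \<Rightarrow> real"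
    and F :: "(real^'n \<Rightarrow> real) set" and r :: real
  assumes "generalized_sierpinski_carpet l S"
    and "self_similar_set l S K"
    and "self_similar_measure l S K \<mu>"
    and "canonical_dirichlet_form l S K \<mu> E F"
    and "scaling_factor l S K E F r"
  shows "walk_dimension l S r > 2"
proof -
  interpret carpet_form K "F \<inter> cont_funs K" E l S r
    by (rule carpet_formI[OF assms])
  have data: "l \<ge> 3" "S \<subset> {i. \<forall>k. i $ k \<in> {0..l - 1}}"
    using assms(1) by (auto simp: generalized_sierpinski_carpet_def carpet_data_def)
  obtain i where "i \<in> S" using S_ne by blast
  moreover obtain j where j: "j \<notin> S" "\<And>k. j $ k \<in> {0..l - 1}" using data(2) by blast
  have "j $ k < l" for k using j(2)[of k] data(1) by simp
  ultimately have "real (card S) > r * (real l)\<^sup>2" using card_gt j(1) by blast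
  then have "(real l)\<^sup>2 < real (card S) / r" using r_pos by (simp add: field_simps)
  then have "log (real l) ((real l)\<^sup>2) < log (real l) (real (card S) / r)"
    using data(1) by (intro log_less) auto
  moreover have "log (real l) ((real l)\<^sup>2) = 2" using data(1) by (simp add: log_nat_power)
  ultimately show ?thesis by (simp add: walk_dimension_def)
qed

end
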